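(* Let $T>0$ and let $f\in\mathcal{L}^1[0,T]$ be a measurable real function. Let $\lambda:[0,\infty)\to[0,\infty)$ be continuous with $\int_0^t\lambda(s)\,ds<\infty$ for all $t\ge0$, let $X$ be a real random variable and let $M(t)=\sum_{k=1}^{N(t)}X_k$ be a compound Poisson process $M\sim CP(\lambda,X)$. For $t>0$ (with $\int_0^t\lambda(u)\,du>0$) let $\Lambda_{t,1},\Lambda_{t,2},\dots$ be i.i.d., independent of $N$ and of $X_1,X_2,\dots$, with $$P\{\Lambda_{t,1}\in ds\}=\frac{\lambda(s)\,ds}{\int_0^t\lambda(u)\,du},\quad s\in[0,t].$$ Then, under Condition II below, for each fixed $0\le t\le T$, $$\int_0^tM(s)f(s)\,ds\ \stackrel{d}{=}\ \sum_{k=1}^{N(t)}X_k\int_{\Lambda_{t,k}}^tf(s)\,ds$$ (for $t=0$ both sides are $0$).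
   Context: $M\sim CP(\lambda,X)$ means $M(t)=\sum_{k=1}^{N(t)}X_k$, $t\ge0$, with $N$ a (non-homogeneous) Poisson process with rate function $\lambda$ and $X_1,X_2,\dots$ i.i.d. copies of $X$, independent of $N$. The symbol $\stackrel{d}{=}$ denotes equality in distribution of random variables. Condition II (standing assumption, for an integral $\int_0^t Z_{N(s)}f(s)\,ds$ with $Z=\{Z_n\}_{n\ge 0}$ a discrete real process, here $Z_n=\sum_{k=1}^nX_k$): if $Z$ is a bounded process, or $Z_n\ge0\ (\le0)$ for all $n$ a.s. and $f\ge0\ (\le0)$, then $N$ is allowed to explode in finite time intervals; otherwise $N$ is assumed not to explode in finite intervals. *)

theory Defs
  imports "HOL-Probability.Probability"
begin

text \<open>
  Counting processes take values in \<^typ>\<open>enat\<close>, the value \<open>\<infinity>\<close> meaning that the process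
  has exploded. Only the times \<open>s \<ge> 0\<close> matter.
\<close>

context prob_space
begin

definition independent_increments :: "(real \<Rightarrow> 'a \<Rightarrow> enat) \<Rightarrow> bool" where
  "independent_increments N \<longleftrightarrow>
     (\<forall>n (\<tau> :: nat \<Rightarrow> real). 0 \<le> \<tau> 0 \<and> (\<forall>i<n. \<tau> i \<le> \<tau> (Suc i)) \<longrightarrow>
        indep_vars (\<lambda>_. count_space UNIV)
          (\<lambda>i \<omega>. N (\<tau> (Suc i)) \<omega> - N (\<tau> i) \<omega>) {..<n})"

definition counting_process :: "(real \<Rightarrow> 'a \<Rightarrow> enat) \<Rightarrow> bool" where
  "counting_process N \<longleftrightarrow>
     (\<forall>s\<ge>0. random_variable (count_space UNIV) (N s)) \<and>
     (\<forall>\<omega>\<in>space M. N 0 \<omega> = 0 \<and> mono_on {0..} (\<lambda>s. N s \<omega>) \<and>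
        (\<forall>s\<ge>0. continuous (at_right s) (\<lambda>u. N u \<omega>)))"

text \<open>
  The Poisson weights are written out because \<^const>\<open>poisson_pmf\<close> requires a positive
  parameter, whereas \<open>\<lambda>\<close> may vanish on a whole interval. Since the weights sum to one,
  an increment is almost surely finite; the value of \<open>\<infinity> - \<infinity>\<close> in \<^typ>\<open>enat\<close>
  (which is \<open>\<infinity>\<close>) plays no role.
\<close>

definition poisson_process :: "(real \<Rightarrow> real) \<Rightarrow> (real \<Rightarrow> 'a \<Rightarrow> enat) \<Rightarrow> bool" where
  "poisson_process lam N \<longleftrightarrow>
     counting_process N \<and> independent_increments N \<and>
     (\<forall>s u n. 0 \<le> s \<and> s \<le> u \<longrightarrow>
        \<P>(\<omega> in M. N u \<omega> - N s \<omega> = enat n) =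
          (LINT r:{s..u}|lborel. lam r) ^ n / fact n * exp (- (LINT r:{s..u}|lborel. lam r)))"

definition iid :: "'i set \<Rightarrow> ('i \<Rightarrow> 'a \<Rightarrow> real) \<Rightarrow> bool" where
  "iid I Y \<longleftrightarrow>
     indep_vars (\<lambda>_. borel) Y I \<and> (\<forall>i\<in>I. \<forall>j\<in>I. distr M borel (Y i) = distr M borel (Y j))"

definition iid_copies :: "(nat \<Rightarrow> 'a \<Rightarrow> real) \<Rightarrow> ('a \<Rightarrow> real) \<Rightarrow> bool" where
  "iid_copies Xs X \<longleftrightarrow>
     random_variable borel X \<and> iid {1..} Xs \<and>
     (\<forall>k\<ge>1. distr M borel (Xs k) = distr M borel X)"

end

text \<open>
  The sum \<open>x\<^sub>1 + \<dots> + x\<^sub>n\<close>. For \<open>n = \<infinity>\<close> it is the infinite series, with the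
  unspecified value of \<^const>\<open>suminf\<close> if that diverges.
\<close>

definition enat_sum :: "enat \<Rightarrow> (nat \<Rightarrow> real) \<Rightarrow> real" where
  "enat_sum n x = (case n of enat m \<Rightarrow> (\<Sum>k=1..m. x k) | \<infinity> \<Rightarrow> (\<Sum>k. x (Suc k)))"

text \<open>A whole process as one random element of a product space, used to express
  independence of processes.\<close>

definition counting_path :: "(real \<Rightarrow> 'a \<Rightarrow> enat) \<Rightarrow> 'a \<Rightarrow> real \<Rightarrow> enat" where
  "counting_path N \<omega> = (\<lambda>s\<in>{0..}. N s \<omega>)"

abbreviation counting_path_space :: "(real \<Rightarrow> enat) measure" where
  "counting_path_space \<equiv> Pi\<^sub>M {0..} (\<lambda>_. count_space UNIV)"

definition seq_path :: "(nat \<Rightarrow> 'a \<Rightarrow> real) \<Rightarrow> 'a \<Rightarrow> nat \<Rightarrow> real" where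
  "seq_path Y \<omega> = (\<lambda>k\<in>{1..}. Y k \<omega>)"

abbreviation seq_path_space :: "(nat \<Rightarrow> real) measure" where
  "seq_path_space \<equiv> Pi\<^sub>M {1..} (\<lambda>_. borel)"

context prob_space
begin

text \<open>Independence of random elements of possibly different types; \<^const>\<open>indep_var\<close>
  requires both to have the same type.\<close>

definition indep_elements :: "'b measure \<Rightarrow> ('a \<Rightarrow> 'b) \<Rightarrow> 'c measure \<Rightarrow> ('a \<Rightarrow> 'c) \<Rightarrow> bool" where
  "indep_elements S A R B \<longleftrightarrow>
     random_variable S A \<and> random_variable R B \<and>
     indep_set {A -` E \<inter> space M | E. E \<in> sets S} {B -` E \<inter> space M | E. E \<in> sets R}"

text \<open>\<open>C \<sim> CP(\<lambda>, X)\<close>, represented by the Poisson process \<open>N\<close> and the copies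
  \<open>X\<^sub>1, X\<^sub>2, \<dots>\<close> of \<open>X\<close>; the entry \<open>Xs 0\<close> is unused.\<close>

definition compound_poisson ::
  "(real \<Rightarrow> real) \<Rightarrow> ('a \<Rightarrow> real) \<Rightarrow> (real \<Rightarrow> 'a \<Rightarrow> enat) \<Rightarrow> (nat \<Rightarrow> 'a \<Rightarrow> real) \<Rightarrow>
     (real \<Rightarrow> 'a \<Rightarrow> real) \<Rightarrow> bool" where
  "compound_poisson lam X N Xs C \<longleftrightarrow>
     poisson_process lam N \<and> iid_copies Xs X \<and>
     indep_elements counting_path_space (counting_path N) seq_path_space (seq_path Xs) \<and>
     (\<forall>s\<ge>0. \<forall>\<omega>\<in>space M. C s \<omega> = enat_sum (N s \<omega>) (\<lambda>k. Xs k \<omega>))"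

text \<open>
  The law \<open>\<lambda>(s) ds / \<integral>\<^sub>0\<^sup>t \<lambda>(u) du\<close> on \<open>[0,t]\<close> only makes sense if the denominator is
  positive. Otherwise \<open>N t = 0\<close> almost surely, and the \<open>L k\<close> may be any random variables.
  Independence is that of the sequence \<open>L\<close> from the pair \<open>(N, Xs)\<close>.
\<close>

definition lambda_sequence ::
  "(real \<Rightarrow> real) \<Rightarrow> (real \<Rightarrow> 'a \<Rightarrow> enat) \<Rightarrow> (nat \<Rightarrow> 'a \<Rightarrow> real) \<Rightarrow> real \<Rightarrow>
     (nat \<Rightarrow> 'a \<Rightarrow> real) \<Rightarrow> bool" where
  "lambda_sequence lam N Xs t L \<longleftrightarrow>
     (\<forall>k\<ge>1. random_variable borel (L k)) \<and>
     (0 < t \<and> 0 < (LINT u:{0..t}|lborel. lam u) \<longrightarrow>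
        iid {1..} L \<and>
        (\<forall>k\<ge>1. distributed M lborel (L k)
           (\<lambda>s. ennreal (indicator {0..t} s * lam s / (LINT u:{0..t}|lborel. lam u)))) \<and>
        indep_elements (counting_path_space \<Otimes>\<^sub>M seq_path_space)
            (\<lambda>\<omega>. (counting_path N \<omega>, seq_path Xs \<omega>))
          seq_path_space (seq_path L))"

definition bounded_process :: "(nat \<Rightarrow> 'a \<Rightarrow> real) \<Rightarrow> bool" where
  "bounded_process Z \<longleftrightarrow> (\<exists>c. AE \<omega> in M. \<forall>n. \<bar>Z n \<omega>\<bar> \<le> c)"

definition constant_sign :: "(nat \<Rightarrow> 'a \<Rightarrow> real) \<Rightarrow> (real \<Rightarrow> real) \<Rightarrow> real \<Rightarrow> bool" where
  "constant_sign Z f t \<longleftrightarrow>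
     ((AE \<omega> in M. \<forall>n. 0 \<le> Z n \<omega>) \<or> (AE \<omega> in M. \<forall>n. Z n \<omega> \<le> 0)) \<and>
     ((\<forall>s\<in>{0..t}. 0 \<le> f s) \<or> (\<forall>s\<in>{0..t}. f s \<le> 0))"

definition non_explosive :: "(real \<Rightarrow> 'a \<Rightarrow> enat) \<Rightarrow> bool" where
  "non_explosive N \<longleftrightarrow> (AE \<omega> in M. \<forall>s\<ge>0. N s \<omega> \<noteq> \<infinity>)"

text \<open>Condition II for the integral of \<open>Z\<^bsub>N(s)\<^esub> f(s)\<close> over \<open>[0,t]\<close>.\<close>

definition condition_II ::
  "(nat \<Rightarrow> 'a \<Rightarrow> real) \<Rightarrow> (real \<Rightarrow> real) \<Rightarrow> real \<Rightarrow> (real \<Rightarrow> 'a \<Rightarrow> enat) \<Rightarrow> bool" where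
  "condition_II Z f t N \<longleftrightarrow> bounded_process Z \<or> constant_sign Z f t \<or> non_explosive N"

text \<open>Measurability is included because \<^const>\<open>distr\<close> carries no information about
  functions that are not measurable.\<close>

definition eq_in_distribution :: "('a \<Rightarrow> real) \<Rightarrow> ('a \<Rightarrow> real) \<Rightarrow> bool" where
  "eq_in_distribution Y Y' \<longleftrightarrow>
     random_variable borel Y \<and> random_variable borel Y' \<and>
     distr M borel Y = distr M borel Y'"

end

end

theory Submission
  imports Defs
begin

text \<open>
  Put \<open>F x = \<integral>\<^sub>x\<^sup>t f(s) ds\<close>. Both sides have the characteristic function
  \<open>exp (\<integral>\<^sub>0\<^sup>t \<lambda>(s) (\<phi> (\<theta> F(s)) - 1) ds)\<close>, where \<open>\<phi>\<close> is that of \<open>X\<close>.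

  On the left, replace \<open>N(s)\<close> by its value at the next point of the grid of mesh \<open>h = t / m\<close>. The
  integral then becomes \<open>\<Sum>k. X\<^sub>k F(j\<^sub>k h)\<close>, where \<open>j\<^sub>k\<close> is the number of the cell that contains the
  \<open>k\<close>-th jump. Integrating out the \<open>X\<^sub>k\<close> leaves a product over the cells of powers
  \<open>\<phi> (\<theta> F(j h))\<close> to the increment of \<open>N\<close>, and the independent Poisson increments give
  \<open>exp (\<Sum>j. \<Lambda>\<^sub>j (\<phi> (\<theta> F(j h)) - 1))\<close>. Let \<open>m \<rightarrow> \<infinity>\<close>, using right continuity of \<open>N\<close>.

  On the right, integrate out first the \<open>\<Lambda>\<^sub>t\<^sub>,\<^sub>k\<close>, then the \<open>X\<^sub>k\<close>, then \<open>N(t)\<close>.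
  Explosions are irrelevant, because the Poisson weights sum to one and so \<open>N(t) < \<infinity>\<close> almost surely.
\<close>

section \<open>Sums with an extended natural number of terms\<close>

lemma measurable_enat_sum [measurable]:
  assumes [measurable]: "n \<in> measurable A (count_space UNIV)"
    and x [measurable]: "\<And>k. 1 \<le> k \<Longrightarrow> (\<lambda>\<omega>. x \<omega> k) \<in> borel_measurable A"
  shows "(\<lambda>\<omega>. enat_sum (n \<omega>) (x \<omega>)) \<in> borel_measurable A"
proof -
  have [measurable]: "(\<lambda>\<omega>. \<Sum>k=1..m. x \<omega> k) \<in> borel_measurable A" for m
    by (rule borel_measurable_sum) (auto intro: x)
  have [measurable]: "(\<lambda>\<omega>. \<Sum>k. x \<omega> (Suc k)) \<in> borel_measurable A"
    by (rule borel_measurable_suminf) (auto intro: x)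
  show ?thesis
    unfolding enat_sum_def by measurable
qed

lemma enat_sum_0 [simp]: "enat_sum 0 x = 0"
  by (simp add: enat_sum_def zero_enat_def)

lemma enat_sum_enat [simp]: "enat_sum (enat m) x = (\<Sum>k=1..m. x k)"
  by (simp add: enat_sum_def)

section \<open>Integrals over independent elements, and Poisson weights\<close>

context prob_space
begin

text \<open>Independence makes the joint law of \<open>A\<close> and \<open>B\<close> the product of
  their laws, and Fubini does the rest. The right-hand side uses two copies \<open>\<omega>\<close>,
  \<open>\<omega>'\<close> of the sample point, so that one source of randomness can be frozen while
  the other is averaged.\<close>

lemma indep_elements_integral:
  fixes G :: "'b \<times> 'c \<Rightarrow> 'd :: {banach, second_countable_topology}"
  assumes ind: "indep_elements S A R B"
    and G [measurable]: "G \<in> borel_measurable (S \<Otimes>\<^sub>M R)"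
    and bound: "\<And>p. p \<in> space (S \<Otimes>\<^sub>M R) \<Longrightarrow> norm (G p) \<le> c"
  shows "(\<integral>\<omega>. G (A \<omega>, B \<omega>) \<partial>M) = (\<integral>\<omega>. (\<integral>\<omega>'. G (A \<omega>, B \<omega>') \<partial>M) \<partial>M)"
proof -
  have [measurable]: "A \<in> measurable M S" "B \<in> measurable M R"
    and set: "indep_set {A -` E \<inter> space M | E. E \<in> sets S} {B -` E \<inter> space M | E. E \<in> sets R}"
    using ind by (auto simp: indep_elements_def)
  interpret DA: prob_space "distr M S A" by (rule prob_space_distr) measurable
  interpret DB: prob_space "distr M R B" by (rule prob_space_distr) measurable
  interpret DP: pair_prob_space "distr M S A" "distr M R B" ..
  have eq: "distr M S A \<Otimes>\<^sub>M distr M R B = distr M (S \<Otimes>\<^sub>M R) (\<lambda>\<omega>. (A \<omega>, B \<omega>))"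
  proof (rule pair_measure_eqI)
    show "sigma_finite_measure (distr M S A)" "sigma_finite_measure (distr M R B)" ..
    show "sets (distr M S A \<Otimes>\<^sub>M distr M R B) = sets (distr M (S \<Otimes>\<^sub>M R) (\<lambda>\<omega>. (A \<omega>, B \<omega>)))"
      by (simp cong: sets_pair_measure_cong)
    fix E F assume "E \<in> sets (distr M S A)" "F \<in> sets (distr M R B)"
    then have [measurable]: "E \<in> sets S" "F \<in> sets R" by auto
    have "emeasure (distr M S A) E * emeasure (distr M R B) F
        = ennreal (prob (A -` E \<inter> space M) * prob (B -` F \<inter> space M))"
      by (simp add: emeasure_distr emeasure_eq_measure ennreal_mult)
    also have "prob (A -` E \<inter> space M) * prob (B -` F \<inter> space M)
        = prob ((A -` E \<inter> space M) \<inter> (B -` F \<inter> space M))"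
      by (rule indep_setD[OF set, symmetric]) auto
    also have "(A -` E \<inter> space M) \<inter> (B -` F \<inter> space M) = (\<lambda>\<omega>. (A \<omega>, B \<omega>)) -` (E \<times> F) \<inter> space M"
      by auto
    finally show "emeasure (distr M S A) E * emeasure (distr M R B) F
        = emeasure (distr M (S \<Otimes>\<^sub>M R) (\<lambda>\<omega>. (A \<omega>, B \<omega>))) (E \<times> F)"
      by (simp add: emeasure_distr emeasure_eq_measure)
  qed
  have Gm: "G \<in> borel_measurable (distr M S A \<Otimes>\<^sub>M distr M R B)"
    by (simp add: eq)
  have "integrable (distr M S A \<Otimes>\<^sub>M distr M R B) G"
    by (rule DP.integrable_const_bound[where B=c])
      (auto intro!: AE_I2 bound Gm simp: space_pair_measure)
  then have "(\<integral>p. G p \<partial>(distr M S A \<Otimes>\<^sub>M distr M R B))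
      = (\<integral>a. (\<integral>b. G (a, b) \<partial>distr M R B) \<partial>distr M S A)"
    by (simp add: DP.integral_fst)
  also have "\<dots> = (\<integral>a. (\<integral>\<omega>'. G (a, B \<omega>') \<partial>M) \<partial>distr M S A)"
    by (intro Bochner_Integration.integral_cong refl integral_distr) auto
  also have "\<dots> = (\<integral>\<omega>. (\<integral>\<omega>'. G (A \<omega>, B \<omega>') \<partial>M) \<partial>M)"
    by (rule integral_distr) measurable
  finally show ?thesis
    by (simp add: eq integral_distr)
qed

text \<open>The weights come from the exponential series, so they add up to
  \<open>exp r * exp (- r)\<close>, which is 1, and leave no mass for
  \<open>\<infinity>\<close>.\<close>

lemma poisson_weights_AE_finite:
  assumes D [measurable]: "random_variable (count_space UNIV) D"
    and P: "\<And>n. \<P>(\<omega> in M. D \<omega> = enat n) = r ^ n / fact n * exp (- r)"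
  shows "AE \<omega> in M. D \<omega> \<noteq> \<infinity>"
proof -
  have "(\<lambda>n. \<P>(\<omega> in M. D \<omega> = enat n)) sums prob (\<Union>n. {\<omega>\<in>space M. D \<omega> = enat n})"
    by (rule finite_measure_UNION) (auto simp: disjoint_family_on_def)
  moreover have "(\<lambda>n. r ^ n /\<^sub>R fact n * exp (- r)) sums (exp r * exp (- r))"
    by (intro sums_mult2 exp_converges)
  then have "(\<lambda>n. \<P>(\<omega> in M. D \<omega> = enat n)) sums 1"
    unfolding P by (simp add: exp_minus divide_inverse mult.commute)
  ultimately have "prob (\<Union>n. {\<omega>\<in>space M. D \<omega> = enat n}) = 1"
    by (rule sums_unique2)
  then have "AE \<omega> in M. \<omega> \<in> (\<Union>n. {\<omega>\<in>space M. D \<omega> = enat n})"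
    by (subst (asm) prob_eq_1) auto
  then show ?thesis
    by (rule eventually_mono) auto
qed

text \<open>Splitting by the value of \<open>D\<close> writes the integrand as a series whose
  integrated partial sums are those of an exponential series. The arbitrary value
  \<open>the_enat \<infinity>\<close> is met only on a null set.\<close>

lemma poisson_weights_generating_function:
  fixes z :: complex
  assumes D [measurable]: "random_variable (count_space UNIV) D"
    and P: "\<And>n. \<P>(\<omega> in M. D \<omega> = enat n) = r ^ n / fact n * exp (- r)"
    and z: "norm z \<le> 1"
  shows "(\<integral>\<omega>. z ^ the_enat (D \<omega>) \<partial>M) = exp (of_real r * (z - 1))"
proof -
  define E where "E n = {\<omega>\<in>space M. D \<omega> = enat n}" for n
  have [measurable]: "E n \<in> sets M" for n
    by (simp add: E_def)
  have "(\<lambda>n. \<integral>\<omega>. (\<Sum>i<n. indicator (E i) \<omega> *\<^sub>R z ^ i) \<partial>M) \<longlonglongrightarrow> (\<integral>\<omega>. z ^ the_enat (D \<omega>) \<partial>M)"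
  proof (rule integral_dominated_convergence[where w="\<lambda>_. 1"])
    have lim: "(\<lambda>n. \<Sum>i<n. indicator (E i) \<omega> *\<^sub>R z ^ i) \<longlonglongrightarrow> z ^ the_enat (D \<omega>)"
      and bd: "norm (\<Sum>i<n. indicator (E i) \<omega> *\<^sub>R z ^ i) \<le> 1"
      if \<omega>: "\<omega> \<in> space M" "D \<omega> \<noteq> \<infinity>" for \<omega> n
    proof -
      obtain k where k: "D \<omega> = enat k" using \<omega> by auto
      \<comment> \<open>At a given point at most one term is nonzero, so the partial sums take only
        the values 0 and \<open>z ^ k\<close>; hence the dominating constant 1.\<close>
      have sum: "(\<Sum>i<n. indicator (E i) \<omega> *\<^sub>R z ^ i) = (if k < n then z ^ k else 0)" for n
      proof -
        have "(\<Sum>i<n. indicator (E i) \<omega> *\<^sub>R z ^ i) = (\<Sum>i<n. if i = k then z ^ k else 0)"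
          by (intro sum.cong refl) (auto simp: E_def k \<omega> indicator_def)
        then show ?thesis by (simp add: sum.delta)
      qed
      show "norm (\<Sum>i<n. indicator (E i) \<omega> *\<^sub>R z ^ i) \<le> 1"
        using z by (simp add: sum norm_power power_le_one)
      show "(\<lambda>n. \<Sum>i<n. indicator (E i) \<omega> *\<^sub>R z ^ i) \<longlonglongrightarrow> z ^ the_enat (D \<omega>)"
        unfolding sum
        by (rule tendsto_eventually, rule eventually_mono[OF eventually_gt_at_top[of k]]) (simp add: k)
    qed
    show "AE \<omega> in M. (\<lambda>n. \<Sum>i<n. indicator (E i) \<omega> *\<^sub>R z ^ i) \<longlonglongrightarrow> z ^ the_enat (D \<omega>)"
      using poisson_weights_AE_finite[OF D P] by (rule AE_mp) (rule AE_I2, rule impI, rule lim)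
    show "AE \<omega> in M. norm (\<Sum>i<n. indicator (E i) \<omega> *\<^sub>R z ^ i) \<le> 1" for n
      using poisson_weights_AE_finite[OF D P] by (rule AE_mp) (rule AE_I2, rule impI, rule bd)
    show "(\<lambda>\<omega>. z ^ the_enat (D \<omega>)) \<in> borel_measurable M"
      by (rule measurable_compose[OF D]) simp
    show "(\<lambda>\<omega>. \<Sum>i<n. indicator (E i) \<omega> *\<^sub>R z ^ i) \<in> borel_measurable M" for n
      by measurable
  qed simp
  moreover have "(\<integral>\<omega>. (\<Sum>i<n. indicator (E i) \<omega> *\<^sub>R z ^ i) \<partial>M)
      = (\<Sum>i<n. (of_real r * z) ^ i /\<^sub>R fact i) * exp (- of_real r)" for n
  proof -
    have "(\<integral>\<omega>. (\<Sum>i<n. indicator (E i) \<omega> *\<^sub>R z ^ i) \<partial>M) = (\<Sum>i<n. prob (E i) *\<^sub>R z ^ i)"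
      by (subst Bochner_Integration.integral_sum)
        (auto simp: emeasure_eq_measure intro!: sum.cong)
    also have "\<dots> = (\<Sum>i<n. (of_real r * z) ^ i /\<^sub>R fact i) * exp (- of_real r)"
      unfolding E_def P sum_distrib_right
      by (intro sum.cong refl)
        (simp add: scaleR_conv_of_real exp_of_real[symmetric] power_mult_distrib field_simps)
    finally show ?thesis .
  qed
  moreover have "(\<lambda>n. (\<Sum>i<n. (of_real r * z) ^ i /\<^sub>R fact i) * exp (- of_real r))
      \<longlonglongrightarrow> exp (of_real r * z) * exp (- of_real r)"
    using exp_converges[of "of_real r * z"] unfolding sums_def by (intro tendsto_intros)
  ultimately have "(\<integral>\<omega>. z ^ the_enat (D \<omega>) \<partial>M) = exp (of_real r * z) * exp (- of_real r)"
    by (simp add: LIMSEQ_unique)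
  then show ?thesis
    by (simp add: exp_add[symmetric] algebra_simps)
qed

lemma iid_copies_integral_eq:
  fixes u :: "real \<Rightarrow> complex"
  assumes iid: "iid_copies Xs X" and k: "1 \<le> k" and [measurable]: "u \<in> borel_measurable borel"
  shows "(\<integral>\<omega>. u (Xs k \<omega>) \<partial>M) = (\<integral>\<omega>. u (X \<omega>) \<partial>M)"
proof -
  have [measurable]: "X \<in> borel_measurable M" "Xs k \<in> borel_measurable M"
    using iid k by (auto simp: iid_copies_def iid_def indep_vars_def)
  have "distr M borel (Xs k) = distr M borel X"
    using iid k by (auto simp: iid_copies_def)
  then have "(\<integral>x. u x \<partial>distr M borel (Xs k)) = (\<integral>x. u x \<partial>distr M borel X)"
    by simp
  then show ?thesis
    by (simp add: integral_distr)
qed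

text \<open>A separate function for each index is allowed because each jump brings its own weight
  into the exponent.\<close>

lemma indep_integral_prod:
  fixes u :: "nat \<Rightarrow> real \<Rightarrow> complex"
  assumes ind: "indep_vars (\<lambda>_. borel) Xs {1..}"
    and u [measurable]: "\<And>k. u k \<in> borel_measurable borel" and bound: "\<And>k x. norm (u k x) \<le> 1"
  shows "(\<integral>\<omega>. (\<Prod>k=1..K. u k (Xs k \<omega>)) \<partial>M) = (\<Prod>k=1..K. \<integral>\<omega>. u k (Xs k \<omega>) \<partial>M)"
proof (rule indep_vars_lebesgue_integral)
  have "indep_vars (\<lambda>_. borel) Xs {1..K}"
    by (rule indep_vars_subset[OF ind]) auto
  then show "indep_vars (\<lambda>_. borel) (\<lambda>k \<omega>. u k (Xs k \<omega>)) {1..K}"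
    by (rule indep_vars_compose2) simp
  fix k assume "k \<in> {1..K}"
  then have [measurable]: "Xs k \<in> borel_measurable M"
    using ind by (auto simp: indep_vars_def)
  show "integrable M (\<lambda>\<omega>. u k (Xs k \<omega>))"
    by (rule integrable_const_bound[where B=1]) (auto intro!: AE_I2 bound)
qed simp

end

subsection \<open>Integrals with a variable lower limit\<close>

definition tail_integral :: "real measure \<Rightarrow> (real \<Rightarrow> real) \<Rightarrow> real \<Rightarrow> real" where
  "tail_integral \<mu> g x = (LINT s:{x..}|\<mu>. g s)"

text \<open>As \<open>y\<close> tends to \<open>x\<close>, the indicators of \<open>{y..}\<close>
  converge at every point except possibly \<open>x\<close> itself, a null set for an atomless
  measure; dominated convergence finishes. The measure is left general because both
  \<open>lborel\<close> and \<open>lebesgue\<close> are used below.\<close>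

lemma continuous_tail_integral:
  assumes g: "integrable \<mu> g"
    and sets: "\<And>x. {x..} \<in> sets \<mu>" and atomless: "\<And>x. AE s in \<mu>. s \<noteq> x"
  shows "continuous_on UNIV (tail_integral \<mu> g)"
proof -
  have [measurable]: "{x..} \<in> sets \<mu>" "g \<in> borel_measurable \<mu>" for x
    using sets g by auto
  have "isCont (tail_integral \<mu> g) x" for x
    unfolding continuous_at_sequentially
  proof (intro allI impI)
    fix y :: "nat \<Rightarrow> real" assume y: "y \<longlonglongrightarrow> x"
    show "((tail_integral \<mu> g) \<circ> y) \<longlonglongrightarrow> tail_integral \<mu> g x"
      unfolding tail_integral_def set_lebesgue_integral_def comp_def
    proof (rule integral_dominated_convergence[where w="\<lambda>s. \<bar>g s\<bar>"])
      show "AE s in \<mu>. (\<lambda>i. indicat_real {y i..} s *\<^sub>R g s) \<longlonglongrightarrow> indicat_real {x..} s *\<^sub>R g s"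
        using atomless[of x]
      proof (rule eventually_mono)
        fix s assume "s \<noteq> x"
        then consider "s < x" | "x < s" by linarith
        then have "eventually (\<lambda>i. indicat_real {y i..} s *\<^sub>R g s = indicat_real {x..} s *\<^sub>R g s) sequentially"
        proof cases
          case 1
          show ?thesis
            using order_tendstoD(1)[OF y 1] by (rule eventually_mono) (use 1 in auto)
        next
          case 2
          show ?thesis
            using order_tendstoD(2)[OF y 2] by (rule eventually_mono) (use 2 in auto)
        qed
        then show "(\<lambda>i. indicat_real {y i..} s *\<^sub>R g s) \<longlonglongrightarrow> indicat_real {x..} s *\<^sub>R g s"
          by (rule tendsto_eventually)
      qed
    qed (use g in \<open>auto simp: indicator_def intro!: AE_I2\<close>)
  qed
  then show ?thesis
    by (simp add: continuous_on_eq_continuous_at)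
qed

lemma continuous_tail_integral_lborel:
  "integrable lborel g \<Longrightarrow> continuous_on UNIV (tail_integral lborel g)"
  by (rule continuous_tail_integral) (auto simp: AE_lborel_singleton)

lemma AE_lebesgue_singleton: "AE s in lebesgue. s \<noteq> (x :: real)"
  by (rule AE_completion) (rule AE_lborel_singleton)

text \<open>The integral is \<open>0\<close> where \<open>f\<close> is not integrable, which happens for all \<open>x\<close> left of
  some threshold.\<close>

lemma borel_measurable_integral_lower_limit:
  fixes f :: "real \<Rightarrow> real"
  shows "(\<lambda>x. LINT s:{x..t}|lebesgue. f s) \<in> borel_measurable borel"
proof -
  define F where "F x = (LINT s:{x..t}|lebesgue. f s)" for x
  define S where "S = {x. set_integrable lebesgue {x..t} f}"
  \<comment> \<open>Shrinking the interval preserves integrability, so \<open>S\<close> is upward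
    closed, hence an interval and a Borel set.\<close>
  have up: "y \<in> S" if "x \<in> S" "x \<le> y" for x y
    using that unfolding S_def by (auto intro: set_integrable_subset)
  have cont: "continuous_on {y..} F" if y: "y \<in> S" for y
  proof -
    \<comment> \<open>Cutting \<open>f\<close> off outside \<open>{y..t}\<close> makes it integrable
      on the whole line; on \<open>{y..}\<close> its tail integral is \<open>F\<close>.\<close>
    have "continuous_on UNIV (tail_integral lebesgue (\<lambda>s. indicat_real {y..t} s *\<^sub>R f s))"
      using y by (intro continuous_tail_integral AE_lebesgue_singleton)
        (auto simp: S_def set_integrable_def)
    then have "continuous_on {y..} (tail_integral lebesgue (\<lambda>s. indicat_real {y..t} s *\<^sub>R f s))"
      by (rule continuous_on_subset) simp
    then show ?thesis
      by (rule continuous_on_eq)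
        (auto simp: tail_integral_def F_def set_lebesgue_integral_def indicator_def
          intro!: Bochner_Integration.integral_cong)
  qed
  have "continuous_on S F"
    unfolding continuous_on_def
  proof
    fix x assume x: "x \<in> S"
    show "(F \<longlongrightarrow> F x) (at x within S)"
    \<comment> \<open>Either \<open>x\<close> is interior to some \<open>{y..}\<close> on which
      \<open>F\<close> is continuous, or \<open>x\<close> is the least element of \<open>S\<close>
      and only limits from the right matter.\<close>
    proof (cases "\<exists>y\<in>S. y < x")
      case True
      then obtain y where y: "y \<in> S" "y < x" by auto
      have "at x within {y..} = at x"
        using y by (intro at_within_interior) simp
      moreover have "(F \<longlongrightarrow> F x) (at x within {y..})"
        using cont[OF y(1)] y by (auto simp: continuous_on_def)
      ultimately have "(F \<longlongrightarrow> F x) (at x)" by simp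
      then show ?thesis
        by (rule tendsto_within_subset) simp
    next
      case False
      then have "S \<subseteq> {x..}" by force
      moreover have "(F \<longlongrightarrow> F x) (at x within {x..})"
        using cont[OF x] by (auto simp: continuous_on_def)
      ultimately show ?thesis
        by (rule tendsto_within_subset[rotated])
    qed
  qed
  moreover have "S \<in> sets borel"
  proof -
    have "is_interval S"
      by (auto simp: is_interval_1 intro: up)
    then show ?thesis by (rule real_interval_borel_measurable)
  qed
  ultimately have "(\<lambda>x. indicator S x *\<^sub>R F x) \<in> borel_measurable borel"
    by (intro borel_measurable_continuous_on_indicator)
  moreover have "(\<lambda>x. indicator S x *\<^sub>R F x) = F"
    by (auto simp: fun_eq_iff S_def F_def set_integrable_def set_lebesgue_integral_def indicator_def
        not_integrable_integral_eq)
  ultimately show ?thesis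
    by (simp add: F_def[abs_def])
qed

subsection \<open>Grids and paths\<close>

text \<open>For \<open>s < 0\<close> the truncation by \<^const>\<open>nat\<close> gives cell \<open>0\<close>. So \<open>rgrid h s\<close> is always a time
  in \<open>{0..}\<close>, the index set of the path space.\<close>

definition cell :: "real \<Rightarrow> real \<Rightarrow> nat" where
  "cell h s = nat \<lfloor>s / h\<rfloor>"

definition lgrid :: "real \<Rightarrow> real \<Rightarrow> real" where
  "lgrid h s = real (cell h s) * h"

definition rgrid :: "real \<Rightarrow> real \<Rightarrow> real" where
  "rgrid h s = real (Suc (cell h s)) * h"

lemma measurable_cell [measurable]: "cell h \<in> measurable borel (count_space UNIV)"
  unfolding cell_def by measurable

lemma measurable_lgrid [measurable]: "lgrid h \<in> borel_measurable borel"
  unfolding lgrid_def by measurable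

lemma le_cell_iff: "0 < h \<Longrightarrow> 0 \<le> s \<Longrightarrow> j \<le> cell h s \<longleftrightarrow> real j * h \<le> s"
  by (simp add: cell_def le_nat_iff le_floor_iff pos_le_divide_eq)

lemma lgrid_le: "0 < h \<Longrightarrow> 0 \<le> s \<Longrightarrow> lgrid h s \<le> s"
  using le_cell_iff[of h s "cell h s"] by (simp add: lgrid_def)

lemma less_rgrid: "0 < h \<Longrightarrow> 0 \<le> s \<Longrightarrow> s < rgrid h s"
  using le_cell_iff[of h s "Suc (cell h s)"] by (simp add: rgrid_def del: of_nat_Suc)

lemma rgrid_eq_lgrid_plus: "rgrid h s = lgrid h s + h"
  by (simp add: rgrid_def lgrid_def algebra_simps)

lemma rgrid_nonneg: "0 < h \<Longrightarrow> 0 \<le> rgrid h s"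
  by (simp add: rgrid_def)

lemma rgrid_le:
  assumes "0 < h" "s < real m * h" "0 \<le> s"
  shows "rgrid h s \<le> real m * h"
proof -
  have "\<not> m \<le> cell h s" using assms by (simp add: le_cell_iff)
  then have "Suc (cell h s) \<le> m" by simp
  then show ?thesis
    using assms(1) unfolding rgrid_def by (intro mult_right_mono) (simp_all del: of_nat_Suc)
qed

lemma tendsto_lgrid:
  assumes h: "h \<longlonglongrightarrow> 0" "\<And>i. 0 < h i" and s: "0 \<le> s"
  shows "(\<lambda>i. lgrid (h i) s) \<longlonglongrightarrow> s"
proof (rule tendsto_sandwich)
  show "\<forall>\<^sub>F i in sequentially. s - h i \<le> lgrid (h i) s"
    using less_rgrid[OF h(2) s] by (auto simp: rgrid_eq_lgrid_plus less_imp_le intro!: always_eventually)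
      (metis add.commute diff_le_eq less_imp_le rgrid_eq_lgrid_plus)
  show "\<forall>\<^sub>F i in sequentially. lgrid (h i) s \<le> s"
    using lgrid_le[OF h(2) s] by simp
  show "(\<lambda>i. s - h i) \<longlonglongrightarrow> s"
    using tendsto_diff[OF tendsto_const h(1), of s] by simp
qed simp

text \<open>The order topology of \<open>enat\<close> isolates finite values, so a monotone
  right-continuous path is constant just after a time with a finite value; at an infinite value
  monotonicity alone suffices. The points \<open>rgrid (h i) s\<close> approach \<open>s\<close>
  strictly from the right.\<close>

lemma eventually_rgrid_eq:
  fixes n :: "real \<Rightarrow> enat"
  assumes mono: "mono_on {0..} n" and cont: "continuous (at_right s) n"
    and h: "h \<longlonglongrightarrow> 0" "\<And>i. 0 < h i" and s: "0 \<le> s"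
  shows "\<forall>\<^sub>F i in sequentially. n (rgrid (h i) s) = n s"
proof -
  have lim: "(\<lambda>i. rgrid (h i) s) \<longlonglongrightarrow> s"
    using tendsto_add[OF tendsto_lgrid[OF h s] h(1)] by (simp add: rgrid_eq_lgrid_plus)
  have ge: "n s \<le> n (rgrid (h i) s)" for i
    using less_rgrid[OF h(2) s, of i] s by (intro monotone_onD[OF mono]) auto
  show ?thesis
  proof (cases "n s")
    case infinity
    then show ?thesis using ge by (simp add: top.extremum_unique[symmetric] top_enat_def)
  next
    case (enat k)
    have "\<forall>\<^sub>F u in at_right s. n u < enat (Suc k)"
      using cont by (intro order_tendstoD(2)[where y="n s"]) (auto simp: continuous_within enat)
    then obtain b where b: "s < b" "\<And>u. s < u \<Longrightarrow> u < b \<Longrightarrow> n u < enat (Suc k)"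
      by (auto simp: eventually_at_right_field)
    have "\<forall>\<^sub>F i in sequentially. rgrid (h i) s < b"
      using order_tendstoD(2)[OF lim b(1)] .
    then show ?thesis
    proof (rule eventually_mono)
      fix i assume "rgrid (h i) s < b"
      then have "n (rgrid (h i) s) < enat (Suc k)"
        by (intro b(2) less_rgrid h(2) s)
      then show "n (rgrid (h i) s) = n s"
        using ge[of i] enat by (cases "n (rgrid (h i) s)") auto
    qed
  qed
qed

text \<open>Consecutive blocks tile \<open>{1..\<nu> m}\<close>. With \<open>\<nu> j\<close> the
  count at the \<open>j\<close>-th grid point, this groups the jumps by cell.\<close>

lemma prod_partition:
  fixes \<nu> :: "nat \<Rightarrow> nat" and p :: "nat \<Rightarrow> 'a :: comm_monoid_mult"
  assumes "\<nu> 0 = 0" "\<And>j. j < m \<Longrightarrow> \<nu> j \<le> \<nu> (Suc j)"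
  shows "(\<Prod>k=1..\<nu> m. p k) = (\<Prod>j<m. \<Prod>k\<in>{\<nu> j<..\<nu> (Suc j)}. p k)"
  using assms(2)
proof (induction m)
  case (Suc m)
  have "{1..\<nu> (Suc m)} = {1..\<nu> m} \<union> {\<nu> m<..\<nu> (Suc m)}"
    using Suc.prems[of m] by auto
  then have "(\<Prod>k=1..\<nu> (Suc m). p k) = (\<Prod>k=1..\<nu> m. p k) * (\<Prod>k\<in>{\<nu> m<..\<nu> (Suc m)}. p k)"
    by (simp, intro prod.union_disjoint) auto
  then show ?case using Suc by simp
qed (simp add: assms)

text \<open>Counting at right end points assigns a jump at a positive grid point to the cell that
  ends there. Sampling a path at \<open>rgrid\<close> has the effect of moving each jump back to the
  left end of its cell.\<close>

definition jump_cell :: "(real \<Rightarrow> enat) \<Rightarrow> real \<Rightarrow> nat \<Rightarrow> nat" where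
  "jump_cell n h k = (LEAST j. enat k \<le> n (real (Suc j) * h))"

text \<open>Summation by parts: the \<open>k\<close>-th summand contributes from its jump time on.\<close>

lemma integral_grid_path:
  fixes n :: "real \<Rightarrow> enat"
  assumes mono: "mono_on {0..} n" and K: "n (real m * h) = enat K" and h: "0 < h"
    and g: "integrable lborel g" and g0: "\<And>s. s \<notin> {0..<real m * h} \<Longrightarrow> g s = 0"
  shows "(\<integral>s. enat_sum (n (rgrid h s)) x * g s \<partial>lborel)
    = (\<Sum>k=1..K. x k * tail_integral lborel g (real (jump_cell n h k) * h))"
proof -
  have ind: "enat k \<le> n (rgrid h s) \<longleftrightarrow> real (jump_cell n h k) * h \<le> s"
    if s: "0 \<le> s" "s < real m * h" and k: "k \<in> {1..K}" for s k
  proof -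
    \<comment> \<open>The time \<open>real m * h\<close> is the right end of cell
      \<open>m - 1\<close>, and all \<open>K\<close> jumps have been counted by then; this witness
      shows that the \<open>LEAST\<close> is attained.\<close>
    have "m \<noteq> 0" using s h by (auto intro!: Nat.gr0I)
    then have "enat k \<le> n (real (Suc (m - 1)) * h)"
      using k K by (simp del: of_nat_Suc)
    then have J: "enat k \<le> n (real (Suc (jump_cell n h k)) * h)"
      unfolding jump_cell_def by (rule LeastI)
    have "enat k \<le> n (rgrid h s) \<longleftrightarrow> jump_cell n h k \<le> cell h s"
    proof
      assume "enat k \<le> n (rgrid h s)"
      then show "jump_cell n h k \<le> cell h s"
        unfolding jump_cell_def rgrid_def by (rule Least_le)
    next
      assume "jump_cell n h k \<le> cell h s"
      then have "n (real (Suc (jump_cell n h k)) * h) \<le> n (rgrid h s)"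
        unfolding rgrid_def using h
        by (intro monotone_onD[OF mono] mult_right_mono) (auto simp del: of_nat_Suc)
      then show "enat k \<le> n (rgrid h s)" using J by simp
    qed
    then show ?thesis using le_cell_iff[OF h s(1)] by simp
  qed
  have pt: "enat_sum (n (rgrid h s)) x * g s
      = (\<Sum>k=1..K. x k * (indicator {real (jump_cell n h k) * h..} s *\<^sub>R g s))" for s
  proof (cases "s \<in> {0..<real m * h}")
    case True
    then have s: "0 \<le> s" "s < real m * h" by auto
    have "n (rgrid h s) \<le> n (real m * h)"
      using h s rgrid_le[of h s m] by (intro monotone_onD[OF mono]) (auto simp: rgrid_nonneg)
    then obtain r where r: "n (rgrid h s) = enat r" "r \<le> K"
      using K by (cases "n (rgrid h s)") auto
    have "enat_sum (n (rgrid h s)) x = (\<Sum>k=1..r. x k)"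
      by (simp add: r)
    \<comment> \<open>The number \<open>r\<close> of terms depends on \<open>s\<close>; over the
      fixed range \<open>{1..K}\<close> the sum can be interchanged with the integral.\<close>
    also have "\<dots> = (\<Sum>k\<in>{1..K}. if k \<le> r then x k else 0)"
      using r(2) by (intro sum.mono_neutral_cong_left) auto
    also have "\<dots> = (\<Sum>k=1..K. x k * indicator {real (jump_cell n h k) * h..} s)"
      using ind[OF s] by (intro sum.cong) (auto simp: r(1))
    finally show ?thesis by (simp only: sum_distrib_right mult.assoc real_scaleR_def)
  next
    case False
    then show ?thesis by (simp add: g0)
  qed
  have "(\<integral>s. enat_sum (n (rgrid h s)) x * g s \<partial>lborel)
      = (\<Sum>k=1..K. \<integral>s. x k * (indicator {real (jump_cell n h k) * h..} s *\<^sub>R g s) \<partial>lborel)"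
    unfolding pt by (intro Bochner_Integration.integral_sum integrable_mult_right integrable_mult_indicator g) simp
  then show ?thesis
    by (simp add: tail_integral_def set_lebesgue_integral_def)
qed

text \<open>Every jump in cell \<open>j\<close> contributes the same factor \<open>G j\<close>, and
  the number of such jumps is the increment over the cell. This brings the increments of the
  counting process into the formula.\<close>

lemma prod_jump_cell:
  fixes n :: "real \<Rightarrow> enat" and G :: "nat \<Rightarrow> 'a :: comm_monoid_mult"
  assumes mono: "mono_on {0..} n" and n0: "n 0 = 0" and K: "n (real m * h) = enat K" and h: "0 < h"
  shows "(\<Prod>k=1..K. G (jump_cell n h k))
    = (\<Prod>j<m. G j ^ the_enat (n (real (Suc j) * h) - n (real j * h)))"
proof -
  define \<nu> where "\<nu> j = the_enat (n (real j * h))" for j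
  have le: "n (real i * h) \<le> n (real j * h)" if "i \<le> j" for i j
    using h that by (intro monotone_onD[OF mono]) auto
  have \<nu>: "n (real j * h) = enat (\<nu> j)" if "j \<le> m" for j
    using le[OF that] K by (cases "n (real j * h)") (auto simp: \<nu>_def)
  have \<nu>_mono: "\<nu> i \<le> \<nu> j" if "i \<le> j" "j \<le> m" for i j
    using le[OF that(1)] \<nu>[of i] \<nu>[of j] that by simp
  \<comment> \<open>At the right end of cell \<open>j\<close> the count has reached
    \<open>k\<close>, while every earlier right end is at most the left end of cell
    \<open>j\<close>, where the count is still below \<open>k\<close>.\<close>
  have cell: "jump_cell n h k = j" if j: "j < m" and k: "k \<in> {\<nu> j<..\<nu> (Suc j)}" for j k
    unfolding jump_cell_def
  proof (rule Least_equality)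
    show "enat k \<le> n (real (Suc j) * h)"
      using \<nu>[of "Suc j"] j k by (simp del: of_nat_Suc)
    fix i assume i: "enat k \<le> n (real (Suc i) * h)"
    show "j \<le> i"
    proof (rule ccontr)
      assume "\<not> j \<le> i"
      then have "n (real (Suc i) * h) \<le> enat (\<nu> j)"
        using le[of "Suc i" j] \<nu>[of j] j by (simp del: of_nat_Suc)
      then have "enat k \<le> enat (\<nu> j)" using i by (rule order_trans[rotated])
      then show False using k by simp
    qed
  qed
  have "(\<Prod>k=1..K. G (jump_cell n h k)) = (\<Prod>k=1..\<nu> m. G (jump_cell n h k))"
    using K \<nu>[of m] by simp
  also have "\<dots> = (\<Prod>j<m. \<Prod>k\<in>{\<nu> j<..\<nu> (Suc j)}. G (jump_cell n h k))"
    by (intro prod_partition \<nu>_mono) (auto simp: \<nu>_def n0 zero_enat_def)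
  also have "\<dots> = (\<Prod>j<m. G j ^ the_enat (n (real (Suc j) * h) - n (real j * h)))"
  proof (rule prod.cong[OF refl])
    fix j assume "j \<in> {..<m}"
    then have j: "j < m" by simp
    have "(\<Prod>k\<in>{\<nu> j<..\<nu> (Suc j)}. G (jump_cell n h k)) = (\<Prod>k\<in>{\<nu> j<..\<nu> (Suc j)}. G j)"
      using cell[OF j] by (intro prod.cong) auto
    then show "(\<Prod>k\<in>{\<nu> j<..\<nu> (Suc j)}. G (jump_cell n h k))
        = G j ^ the_enat (n (real (Suc j) * h) - n (real j * h))"
      using \<nu>[of j] \<nu>[of "Suc j"] j by (simp del: of_nat_Suc)
  qed
  finally show ?thesis .
qed

subsection \<open>The characteristic functions\<close>

lemma norm_iexp_mult [simp]: "norm (iexp (a * b)) = 1"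
  by (simp add: norm_exp_i_times)

text \<open>Here \<open>g\<close> stands for a Borel version of \<open>f\<close> cut off outside
  \<open>{0..<t}\<close>. The half-open support is tiled exactly by the grid cells.\<close>

locale compound_poisson_integral = prob_space +
  fixes lam :: "real \<Rightarrow> real" and X :: "'a \<Rightarrow> real" and N :: "real \<Rightarrow> 'a \<Rightarrow> enat"
    and Xs :: "nat \<Rightarrow> 'a \<Rightarrow> real" and C :: "real \<Rightarrow> 'a \<Rightarrow> real" and t :: real and g :: "real \<Rightarrow> real"
  assumes cp: "compound_poisson lam X N Xs C"
    and t_pos: "0 < t"
    and lam_integrable: "\<And>s. 0 \<le> s \<Longrightarrow> set_integrable lborel {0..s} lam"
    and g: "integrable lborel g"
    and g_0: "\<And>s. s \<notin> {0..<t} \<Longrightarrow> g s = 0"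
begin

definition rate :: "real \<Rightarrow> real \<Rightarrow> real" where
  "rate s u = (LINT r:{s..u}|lborel. lam r)"

abbreviation \<phi> :: "real \<Rightarrow> complex" where
  "\<phi> \<equiv> char (distr M borel X)"

abbreviation F :: "real \<Rightarrow> real" where
  "F \<equiv> tail_integral lborel g"

lemma g_measurable [measurable]: "g \<in> borel_measurable borel"
  using borel_measurable_integrable[OF g] by simp

lemma poisson: "poisson_process lam N"
  and iid: "iid_copies Xs X"
  and ind: "indep_elements counting_path_space (counting_path N) seq_path_space (seq_path Xs)"
  using cp by (auto simp: compound_poisson_def)

lemma N_measurable [measurable]: "0 \<le> s \<Longrightarrow> N s \<in> measurable M (count_space UNIV)"
  and N_0: "\<omega> \<in> space M \<Longrightarrow> N 0 \<omega> = 0"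
  and N_mono: "\<omega> \<in> space M \<Longrightarrow> mono_on {0..} (\<lambda>s. N s \<omega>)"
  and N_cont: "\<omega> \<in> space M \<Longrightarrow> 0 \<le> s \<Longrightarrow> continuous (at_right s) (\<lambda>u. N u \<omega>)"
  using poisson by (auto simp: poisson_process_def counting_process_def)

lemma N_prob: "0 \<le> s \<Longrightarrow> s \<le> u \<Longrightarrow>
    \<P>(\<omega> in M. N u \<omega> - N s \<omega> = enat n) = rate s u ^ n / fact n * exp (- rate s u)"
  using poisson by (auto simp: poisson_process_def rate_def)

lemma N_prob_0: "\<P>(\<omega> in M. N t \<omega> = enat n) = rate 0 t ^ n / fact n * exp (- rate 0 t)"
proof -
  have "\<P>(\<omega> in M. N t \<omega> = enat n) = \<P>(\<omega> in M. N t \<omega> - N 0 \<omega> = enat n)"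
    by (intro arg_cong[where f=prob]) (auto simp: N_0 simp flip: zero_enat_def)
  then show ?thesis using N_prob[of 0 t n] t_pos by simp
qed

lemma N_finite: "AE \<omega> in M. N t \<omega> \<noteq> \<infinity>"
  using t_pos by (intro poisson_weights_AE_finite[where r="rate 0 t"] N_prob_0) simp

lemma X_measurable [measurable]: "X \<in> borel_measurable M"
  and Xs_measurable [measurable]: "1 \<le> k \<Longrightarrow> Xs k \<in> borel_measurable M"
  and Xs_indep: "indep_vars (\<lambda>_. borel) Xs {1..}"
  using iid by (auto simp: iid_copies_def iid_def indep_vars_def)

sublocale X: real_distribution "distr M borel X"
  by (rule real_distribution_distr) simp

lemma \<phi>_eq: "\<phi> \<theta> = (\<integral>\<omega>. iexp (\<theta> * X \<omega>) \<partial>M)"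
  by (simp add: char_def integral_distr)

lemma norm_\<phi>_le: "norm (\<phi> \<theta>) \<le> 1"
  by (rule X.cmod_char_le_1)

lemma \<phi>_measurable [measurable]: "\<phi> \<in> borel_measurable borel"
  by (intro borel_measurable_continuous_onI continuous_at_imp_continuous_on ballI X.isCont_char)

lemma F_cont: "continuous_on UNIV F"
  by (rule continuous_tail_integral_lborel[OF g])

lemma F_measurable [measurable]: "F \<in> borel_measurable borel"
  by (intro borel_measurable_continuous_onI F_cont)

lemma lam_indicator_integrable: "integrable lborel (\<lambda>s. indicator {0..<t} s *\<^sub>R lam s)"
proof -
  have "set_integrable lborel {0..<t} lam"
    by (rule set_integrable_subset[OF lam_integrable[of t]]) (use t_pos in auto)
  then show ?thesis by (simp add: set_integrable_def)
qed

lemma integrable_lam_mult: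
  assumes [measurable]: "H \<in> borel_measurable borel" and H: "\<And>s. norm (H s :: complex) \<le> c"
  shows "integrable lborel (\<lambda>s. (indicator {0..<t} s * lam s) *\<^sub>R H s)"
proof (rule Bochner_Integration.integrable_bound)
  show "integrable lborel (\<lambda>s. c * (indicator {0..<t} s *\<^sub>R lam s))"
    using lam_indicator_integrable by simp
  have [measurable]: "(\<lambda>s. indicator {0..<t} s * lam s) \<in> borel_measurable lborel"
    using borel_measurable_integrable[OF lam_indicator_integrable] by simp
  show "(\<lambda>s. (indicator {0..<t} s * lam s) *\<^sub>R H s) \<in> borel_measurable lborel"
    by measurable
  have "norm (H s) * \<bar>lam s\<bar> \<le> \<bar>c * lam s\<bar>" for s
    using mult_right_mono[OF order_trans[OF H abs_ge_self], of "\<bar>lam s\<bar>"] by (simp add: abs_mult)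
  then show "AE s in lborel. norm ((indicator {0..<t} s * lam s) *\<^sub>R H s)
      \<le> norm (c * (indicator {0..<t} s *\<^sub>R lam s))"
    by (auto simp: indicator_def mult.commute)
qed

text \<open>On cell \<open>j\<close> the function \<open>lgrid h\<close> is constantly
  \<open>real j * h\<close>, so the sum over the cells is exactly the integral of a step function.
  The limit of vanishing mesh thus becomes a matter of dominated convergence.\<close>

lemma sum_rate:
  fixes H :: "real \<Rightarrow> complex"
  assumes m: "0 < m" and h: "h = t / real m"
  shows "(\<Sum>j<m. of_real (rate (real j * h) (real (Suc j) * h)) * H (real j * h))
    = (\<integral>s. (indicator {0..<t} s * lam s) *\<^sub>R H (lgrid h s) \<partial>lborel)"
proof -
  have h0: "0 < h" and mh: "real m * h = t" using m t_pos by (auto simp: h)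
  have lt: "real (Suc j) * h \<le> t" if "j < m" for j
    using that mult_right_mono[of "real (Suc j)" "real m" h] h0 mh by simp
  have sub: "{real j * h..real (Suc j) * h} \<subseteq> {0..t}" if "j < m" for j
    using lt[OF that] mult_nonneg_nonneg[of "real j" h] h0
    by (auto simp del: of_nat_Suc mult_nonneg_nonneg zero_le_mult_iff intro: order_trans)
  have "of_real (rate (real j * h) (real (Suc j) * h)) * H (real j * h)
      = (\<integral>s. (indicator {real j * h..<real (Suc j) * h} s * lam s) *\<^sub>R H (real j * h) \<partial>lborel)"
    and int: "integrable lborel (\<lambda>s. (indicator {real j * h..<real (Suc j) * h} s * lam s) *\<^sub>R H (real j * h))"
    if j: "j < m" for j
  proof -
    note sub = sub[OF j]
    have i: "set_integrable lborel {real j * h..<real (Suc j) * h} lam"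
      by (rule set_integrable_subset[OF lam_integrable[of t]]) (use sub t_pos in auto)
    then show "integrable lborel (\<lambda>s. (indicator {real j * h..<real (Suc j) * h} s * lam s) *\<^sub>R H (real j * h))"
      by (intro integrable_scaleR_left) (simp add: set_integrable_def)
    \<comment> \<open>\<open>rate\<close> integrates over closed intervals while the cells are
      half-open; the extra end point is a null set.\<close>
    have "rate (real j * h) (real (Suc j) * h) = (LINT r:{real j * h..<real (Suc j) * h}|lborel. lam r)"
    proof -
      have i': "set_integrable lborel {real j * h..real (Suc j) * h} lam"
        by (rule set_integrable_subset[OF lam_integrable[of t]]) (use sub t_pos in auto)
      show ?thesis
        unfolding rate_def set_lebesgue_integral_def
      proof (rule integral_cong_AE)
        show "AE s in lborel. indicat_real {real j * h..real (Suc j) * h} s *\<^sub>R lam s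
            = indicat_real {real j * h..<real (Suc j) * h} s *\<^sub>R lam s"
          using AE_lborel_singleton[of "real (Suc j) * h"]
          by (rule eventually_mono) (auto simp: indicator_def)
      qed (use i i' in \<open>auto simp: set_integrable_def\<close>)
    qed
    then show "of_real (rate (real j * h) (real (Suc j) * h)) * H (real j * h)
      = (\<integral>s. (indicator {real j * h..<real (Suc j) * h} s * lam s) *\<^sub>R H (real j * h) \<partial>lborel)"
      using i by (subst integral_scaleR_left)
        (simp_all add: set_integrable_def set_lebesgue_integral_def scaleR_conv_of_real)
  qed
  then have "(\<Sum>j<m. of_real (rate (real j * h) (real (Suc j) * h)) * H (real j * h))
      = (\<Sum>j<m. \<integral>s. (indicator {real j * h..<real (Suc j) * h} s * lam s) *\<^sub>R H (real j * h) \<partial>lborel)"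
    by (intro sum.cong) auto
  also have "\<dots> = (\<integral>s. (\<Sum>j<m. (indicator {real j * h..<real (Suc j) * h} s * lam s) *\<^sub>R H (real j * h)) \<partial>lborel)"
    by (rule Bochner_Integration.integral_sum[symmetric], rule int) simp
  also have "\<dots> = (\<integral>s. (indicator {0..<t} s * lam s) *\<^sub>R H (lgrid h s) \<partial>lborel)"
  proof (rule Bochner_Integration.integral_cong[OF refl])
    fix s :: real
    show "(\<Sum>j<m. (indicator {real j * h..<real (Suc j) * h} s * lam s) *\<^sub>R H (real j * h))
        = (indicator {0..<t} s * lam s) *\<^sub>R H (lgrid h s)"
    proof (cases "s \<in> {0..<t}")
      case True
      then have s: "0 \<le> s" "s < real m * h" by (auto simp: mh)
      have iff: "s \<in> {real j * h..<real (Suc j) * h} \<longleftrightarrow> j = cell h s" for j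
        using le_cell_iff[OF h0 s(1), of j] le_cell_iff[OF h0 s(1), of "Suc j"]
        by (auto simp del: of_nat_Suc)
      have "cell h s < m"
        using le_cell_iff[OF h0 s(1), of m] s by auto
      moreover have "(\<Sum>j<m. (indicator {real j * h..<real (Suc j) * h} s * lam s) *\<^sub>R H (real j * h))
          = (\<Sum>j<m. if j = cell h s then lam s *\<^sub>R H (real j * h) else 0)"
        using iff by (intro sum.cong) (auto simp: indicator_def)
      ultimately show ?thesis
        using True by (simp add: lgrid_def)
    next
      case False
      have "s \<notin> {real j * h..<real (Suc j) * h}" if "j < m" for j
        using False lt[OF that] subsetD[OF sub[OF that], of s] by (auto simp del: of_nat_Suc)
      then show ?thesis
        using False by (auto intro!: sum.neutral)
    qed
  qed
  finally show ?thesis .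
qed

text \<open>A functional of the pair of paths rather than of \<open>\<omega>\<close>, so that
  \<open>indep_elements_integral\<close> can average over the two paths separately.\<close>

definition grid_integral :: "real \<Rightarrow> (real \<Rightarrow> enat) \<times> (nat \<Rightarrow> real) \<Rightarrow> real" where
  "grid_integral h p = (\<integral>s. enat_sum (fst p (rgrid h s)) (snd p) * g s \<partial>lborel)"

text \<open>Evaluation of a path at a variable time is in general not measurable for the product
  sigma-algebra. The times \<open>rgrid h s\<close> form a countable set, so it is enough to
  evaluate at each fixed one of them.\<close>

lemma measurable_grid_integrand:
  assumes h: "0 < h"
  shows "(\<lambda>q. enat_sum (fst (fst q) (rgrid h (snd q))) (snd (fst q)) * g (snd q))
    \<in> borel_measurable ((counting_path_space \<Otimes>\<^sub>M seq_path_space) \<Otimes>\<^sub>M lborel)"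
    (is "_ \<in> borel_measurable ?S")
proof -
  have n: "(\<lambda>q. fst (fst q) (rgrid h (snd q))) \<in> measurable ?S (count_space UNIV)"
    unfolding rgrid_def
  proof (rule measurable_compose_countable[where f="\<lambda>j q. fst (fst q) (real (Suc j) * h)" and g="\<lambda>q. cell h (snd q)"])
    fix j
    have "real (Suc j) * h \<in> {0..}" using h by simp
    then have "(\<lambda>n. n (real (Suc j) * h)) \<in> measurable counting_path_space (count_space UNIV)"
      by (rule measurable_component_singleton)
    then show "(\<lambda>q. fst (fst q) (real (Suc j) * h)) \<in> measurable ?S (count_space UNIV)"
      by (rule measurable_compose[rotated]) measurable
  qed measurable
  have x: "(\<lambda>q. snd (fst q) k) \<in> borel_measurable ?S" if "1 \<le> k" for k
  proof -
    have "(\<lambda>x. x k) \<in> borel_measurable seq_path_space"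
      using that by (intro measurable_component_singleton) simp
    then show ?thesis
      by (rule measurable_compose[rotated]) measurable
  qed
  show ?thesis
    by (intro borel_measurable_times measurable_enat_sum n x) measurable
qed

lemma measurable_grid_integral [measurable]:
  assumes h: "0 < h"
  shows "grid_integral h \<in> borel_measurable (counting_path_space \<Otimes>\<^sub>M seq_path_space)"
  unfolding grid_integral_def
  using measurable_grid_integrand[OF h]
  by (intro lborel.borel_measurable_lebesgue_integral) (simp add: split_beta')

lemma measurable_path:
  "(\<lambda>\<omega>. (counting_path N \<omega>, seq_path Xs \<omega>)) \<in> measurable M (counting_path_space \<Otimes>\<^sub>M seq_path_space)"
  using ind by (auto simp: indep_elements_def intro: measurable_Pair)

lemma counting_path_props:
  assumes "\<omega> \<in> space M"
  shows "mono_on {0..} (counting_path N \<omega>)" "counting_path N \<omega> 0 = 0"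
    "0 \<le> s \<Longrightarrow> counting_path N \<omega> s = N s \<omega>"
  using N_mono[OF assms] N_0[OF assms] by (auto simp: counting_path_def monotone_on_def)

text \<open>The formula is exact for every mesh; all approximation is left to the passage to the
  limit.\<close>

lemma grid_integral_cf:
  assumes m: "0 < m" and h: "h = t / real m"
  shows "(\<integral>\<omega>. iexp (\<theta> * grid_integral h (counting_path N \<omega>, seq_path Xs \<omega>)) \<partial>M)
    = exp (\<integral>s. (indicator {0..<t} s * lam s) *\<^sub>R (\<phi> (\<theta> * F (lgrid h s)) - 1) \<partial>lborel)"
proof -
  have h0: "0 < h" and mh: "real m * h = t" using m t_pos by (auto simp: h)
  note [measurable] = measurable_grid_integral[OF h0]
  define D where "D j \<omega> = N (real (Suc j) * h) \<omega> - N (real j * h) \<omega>" for j \<omega>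
  define z where "z j = \<phi> (\<theta> * F (real j * h))" for j
  have D_meas [measurable]: "D j \<in> measurable M (count_space UNIV)" for j
  proof -
    have [measurable]: "N (real (Suc j) * h) \<in> measurable M (count_space UNIV)"
        "N (real j * h) \<in> measurable M (count_space UNIV)"
      using h0 by (auto simp del: of_nat_Suc)
    show ?thesis unfolding D_def by measurable
  qed
  \<comment> \<open>With the path of \<open>N\<close> frozen and \<open>N t\<close> finite, the
    integral is a linear combination of the \<open>Xs k\<close> with fixed coefficients;
    independence turns the expectation into a product of values of \<open>\<phi>\<close>, which is
    then grouped by cells.\<close>
  have inner: "(\<integral>\<omega>'. iexp (\<theta> * grid_integral h (counting_path N \<omega>, seq_path Xs \<omega>')) \<partial>M)
      = (\<Prod>j<m. z j ^ the_enat (D j \<omega>))"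
    if \<omega>: "\<omega> \<in> space M" and fin: "N t \<omega> \<noteq> \<infinity>" for \<omega>
  proof -
    obtain K where K: "N t \<omega> = enat K" using fin by auto
    define c where "c k = F (real (jump_cell (counting_path N \<omega>) h k) * h)" for k
    have K': "counting_path N \<omega> (real m * h) = enat K"
      using K t_pos by (simp add: mh counting_path_props[OF \<omega>])
    have "grid_integral h (counting_path N \<omega>, seq_path Xs \<omega>') = (\<Sum>k=1..K. seq_path Xs \<omega>' k * c k)" for \<omega>'
      unfolding grid_integral_def fst_conv snd_conv c_def
      using g_0 by (intro integral_grid_path[OF counting_path_props(1)[OF \<omega>] K' h0 g]) (simp add: mh)
    also have "(\<Sum>k=1..K. seq_path Xs \<omega>' k * c k) = (\<Sum>k=1..K. c k * Xs k \<omega>')" for \<omega>'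
      by (intro sum.cong) (auto simp: seq_path_def)
    finally have "(\<integral>\<omega>'. iexp (\<theta> * grid_integral h (counting_path N \<omega>, seq_path Xs \<omega>')) \<partial>M)
        = (\<integral>\<omega>'. (\<Prod>k=1..K. iexp (\<theta> * c k * Xs k \<omega>')) \<partial>M)"
      by (simp add: sum_distrib_left exp_sum[symmetric] mult.assoc)
    also have "\<dots> = (\<Prod>k=1..K. \<integral>\<omega>'. iexp (\<theta> * c k * Xs k \<omega>') \<partial>M)"
      by (rule indep_integral_prod[OF Xs_indep, where u="\<lambda>k x. iexp (\<theta> * c k * x)"]) auto
    also have "\<dots> = (\<Prod>k=1..K. z (jump_cell (counting_path N \<omega>) h k))"
      by (intro prod.cong refl, subst iid_copies_integral_eq[OF iid, where u="\<lambda>x. iexp (_ * x)"])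
        (auto simp: z_def c_def \<phi>_eq)
    also have "\<dots> = (\<Prod>j<m. z j ^ the_enat (D j \<omega>))"
      by (subst prod_jump_cell[OF counting_path_props(1,2)[OF \<omega>] K' h0])
        (use h0 in \<open>simp add: D_def counting_path_props[OF \<omega>] del: of_nat_Suc\<close>)
    finally show ?thesis .
  qed
  have "(\<integral>\<omega>. iexp (\<theta> * grid_integral h (counting_path N \<omega>, seq_path Xs \<omega>)) \<partial>M)
      = (\<integral>\<omega>. (\<integral>\<omega>'. iexp (\<theta> * grid_integral h (counting_path N \<omega>, seq_path Xs \<omega>')) \<partial>M) \<partial>M)"
  proof (rule indep_elements_integral[OF ind])
    show "(\<lambda>p. iexp (\<theta> * grid_integral h p)) \<in> borel_measurable (counting_path_space \<Otimes>\<^sub>M seq_path_space)"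
      by measurable
  qed (rule norm_iexp_mult[THEN eq_refl])
  \<comment> \<open>The inner formula is available for paths that are finite at \<open>t\<close>,
    that is, almost surely.\<close>
  also have "\<dots> = (\<integral>\<omega>. (\<Prod>j<m. z j ^ the_enat (D j \<omega>)) \<partial>M)"
  proof (rule integral_cong_AE)
    show "AE \<omega> in M. (\<integral>\<omega>'. iexp (\<theta> * grid_integral h (counting_path N \<omega>, seq_path Xs \<omega>')) \<partial>M)
        = (\<Prod>j<m. z j ^ the_enat (D j \<omega>))"
      using N_finite by (rule AE_mp) (rule AE_I2, rule impI, rule inner)
    have [measurable]: "counting_path N \<in> measurable M counting_path_space"
        "seq_path Xs \<in> measurable M seq_path_space"
      using ind by (auto simp: indep_elements_def)
    show "(\<lambda>\<omega>. \<integral>\<omega>'. iexp (\<theta> * grid_integral h (counting_path N \<omega>, seq_path Xs \<omega>')) \<partial>M) \<in> borel_measurable M"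
      by (rule borel_measurable_lebesgue_integral) measurable
    show "(\<lambda>\<omega>. \<Prod>j<m. z j ^ the_enat (D j \<omega>)) \<in> borel_measurable M"
      by (intro borel_measurable_prod measurable_compose[OF D_meas]) simp
  qed
  also have "\<dots> = (\<Prod>j<m. \<integral>\<omega>. z j ^ the_enat (D j \<omega>) \<partial>M)"
  proof (rule indep_vars_lebesgue_integral)
    have "indep_vars (\<lambda>_. count_space UNIV) D {..<m}"
      using poisson h0 unfolding poisson_process_def independent_increments_def D_def
      by (auto elim!: allE[of _ m] allE[of _ "\<lambda>j. real j * h"])
    then show "indep_vars (\<lambda>_. borel) (\<lambda>j \<omega>. z j ^ the_enat (D j \<omega>)) {..<m}"
      by (rule indep_vars_compose2) simp
    fix j
    show "integrable M (\<lambda>\<omega>. z j ^ the_enat (D j \<omega>))"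
      using norm_\<phi>_le
      by (intro integrable_const_bound[where B=1] AE_I2 measurable_compose[OF D_meas])
        (auto simp: norm_power z_def intro: power_le_one)
  qed simp
  also have "\<dots> = (\<Prod>j<m. exp (of_real (rate (real j * h) (real (Suc j) * h)) * (z j - 1)))"
  proof (intro prod.cong refl poisson_weights_generating_function D_meas)
    fix j n
    show "\<P>(\<omega> in M. D j \<omega> = enat n) = rate (real j * h) (real (Suc j) * h) ^ n / fact n
        * exp (- rate (real j * h) (real (Suc j) * h))"
      unfolding D_def using h0 by (intro N_prob) (auto intro!: mult_right_mono)
    show "norm (z j) \<le> 1" by (simp add: z_def norm_\<phi>_le)
  qed
  also have "\<dots> = exp (\<Sum>j<m. of_real (rate (real j * h) (real (Suc j) * h)) * (\<phi> (\<theta> * F (real j * h)) - 1))"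
    by (simp add: exp_sum z_def)
  finally show ?thesis
    using sum_rate[OF m h, of "\<lambda>s. \<phi> (\<theta> * F s) - 1"] by simp
qed

end

section \<open>The limit of vanishing mesh\<close>

lemma enat_sum_cong: "(\<And>k. 1 \<le> k \<Longrightarrow> x k = y k) \<Longrightarrow> enat_sum n x = enat_sum n y"
  by (auto simp: enat_sum_def split: enat.split intro!: sum.cong)

text \<open>The bound does not depend on \<open>n\<close>, so one constant per sample point
  dominates all grid approximations of its path.\<close>

lemma abs_enat_sum_le:
  assumes "n \<le> enat K"
  shows "\<bar>enat_sum n x\<bar> \<le> (\<Sum>k=1..K. \<bar>x k\<bar>)"
proof -
  obtain r where r: "n = enat r" "r \<le> K" using assms by (cases n) auto
  have "\<bar>enat_sum n x\<bar> \<le> (\<Sum>k=1..r. \<bar>x k\<bar>)"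
    by (simp add: r(1) sum_abs)
  also have "\<dots> \<le> (\<Sum>k=1..K. \<bar>x k\<bar>)"
    using r(2) by (intro sum_mono2) auto
  finally show ?thesis .
qed

context prob_space
begin

lemma eq_in_distribution_AE:
  assumes "Y \<in> borel_measurable M" "Y' \<in> borel_measurable M" "AE \<omega> in M. Y \<omega> = Y' \<omega>"
  shows "eq_in_distribution Y Y'"
  unfolding eq_in_distribution_def using assms by (auto intro: distr_cong_AE)

lemma eq_in_distribution_char:
  assumes [measurable]: "Y \<in> borel_measurable M" "Y' \<in> borel_measurable M"
    and eq: "\<And>\<theta>. (\<integral>\<omega>. iexp (\<theta> * Y \<omega>) \<partial>M) = (\<integral>\<omega>. iexp (\<theta> * Y' \<omega>) \<partial>M)"
  shows "eq_in_distribution Y Y'"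
proof -
  have "distr M borel Y = distr M borel Y'"
    by (intro Levy_uniqueness real_distribution_distr ext) (simp_all add: char_def integral_distr eq del: of_real_mult)
  then show ?thesis
    by (simp add: eq_in_distribution_def)
qed

end

context compound_poisson_integral
begin

text \<open>With \<open>Suc i\<close> cells of this length the grid ends exactly at
  \<open>t\<close>, so the right grid point of a time before \<open>t\<close> never lies beyond
  \<open>t\<close>.\<close>

definition mesh :: "nat \<Rightarrow> real" where
  "mesh i = t / real (Suc i)"

lemma mesh_pos: "0 < mesh i"
  using t_pos by (simp add: mesh_def)

lemma tendsto_mesh: "mesh \<longlonglongrightarrow> 0"
  unfolding mesh_def by (rule LIMSEQ_Suc) (rule lim_const_over_n)

definition path_integral :: "'a \<Rightarrow> real" where
  "path_integral \<omega> = (\<integral>s. enat_sum (N s \<omega>) (\<lambda>k. Xs k \<omega>) * g s \<partial>lborel)"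

text \<open>The sampled count is eventually equal to \<open>N s \<omega>\<close>, not merely close
  to it; this also covers the value \<open>\<infinity>\<close>, where \<open>enat_sum\<close> may be
  discontinuous.\<close>

lemma tendsto_grid_integrand:
  assumes \<omega>: "\<omega> \<in> space M"
  shows "(\<lambda>i. enat_sum (counting_path N \<omega> (rgrid (mesh i) s)) (seq_path Xs \<omega>) * g s)
    \<longlonglongrightarrow> enat_sum (N s \<omega>) (\<lambda>k. Xs k \<omega>) * g s"
proof (cases "0 \<le> s")
  case True
  have eq: "enat_sum n (seq_path Xs \<omega>) = enat_sum n (\<lambda>k. Xs k \<omega>)" for n
    by (rule enat_sum_cong) (simp add: seq_path_def)
  have "\<forall>\<^sub>F i in sequentially. N (rgrid (mesh i) s) \<omega> = N s \<omega>"
    by (intro eventually_rgrid_eq[where n="\<lambda>s. N s \<omega>"] N_mono N_cont \<omega> True tendsto_mesh mesh_pos)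
  then show ?thesis
    by (intro tendsto_eventually, elim eventually_mono)
      (simp add: eq counting_path_props(3)[OF \<omega>] rgrid_nonneg mesh_pos)
next
  case False
  then show ?thesis by (simp add: g_0)
qed

text \<open>Joint measurability in \<open>\<omega>\<close> and \<open>s\<close> is inherited from
  the grid integrands, of which this is the pointwise limit.\<close>

lemma measurable_path_integrand:
  "(\<lambda>(\<omega>, s). enat_sum (N s \<omega>) (\<lambda>k. Xs k \<omega>) * g s) \<in> borel_measurable (M \<Otimes>\<^sub>M lborel)"
proof (rule borel_measurable_LIMSEQ_real)
  fix i
  have "(\<lambda>p. ((counting_path N (fst p), seq_path Xs (fst p)), snd p))
      \<in> measurable (M \<Otimes>\<^sub>M lborel) ((counting_path_space \<Otimes>\<^sub>M seq_path_space) \<Otimes>\<^sub>M lborel)"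
    by (intro measurable_Pair[of "\<lambda>p. (counting_path N (fst p), seq_path Xs (fst p))"]
        measurable_compose[OF _ measurable_path]) measurable
  from measurable_compose[OF this measurable_grid_integrand[OF mesh_pos]]
  show "(\<lambda>p. enat_sum (counting_path N (fst p) (rgrid (mesh i) (snd p))) (seq_path Xs (fst p)) * g (snd p))
      \<in> borel_measurable (M \<Otimes>\<^sub>M lborel)"
    by simp
next
  fix p assume "p \<in> space (M \<Otimes>\<^sub>M (lborel :: real measure))"
  then show "(\<lambda>i. enat_sum (counting_path N (fst p) (rgrid (mesh i) (snd p))) (seq_path Xs (fst p)) * g (snd p))
      \<longlonglongrightarrow> (case p of (\<omega>, s) \<Rightarrow> enat_sum (N s \<omega>) (\<lambda>k. Xs k \<omega>) * g s)"
    using tendsto_grid_integrand[of "fst p" "snd p"] by (auto simp: space_pair_measure)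
qed

lemma measurable_path_integral [measurable]: "path_integral \<in> borel_measurable M"
  unfolding path_integral_def using measurable_path_integrand
  by (rule lborel.borel_measurable_lebesgue_integral)

lemma tendsto_grid_integral:
  assumes \<omega>: "\<omega> \<in> space M" and fin: "N t \<omega> \<noteq> \<infinity>"
  shows "(\<lambda>i. grid_integral (mesh i) (counting_path N \<omega>, seq_path Xs \<omega>)) \<longlonglongrightarrow> path_integral \<omega>"
proof -
  obtain K where K: "N t \<omega> = enat K" using fin by auto
  let ?c = "\<Sum>k=1..K. \<bar>seq_path Xs \<omega> k\<bar>"
  show ?thesis
    unfolding grid_integral_def path_integral_def fst_conv snd_conv
  proof (rule integral_dominated_convergence[where w="\<lambda>s. ?c * \<bar>g s\<bar>"])
    show "AE s in lborel. (\<lambda>i. enat_sum (counting_path N \<omega> (rgrid (mesh i) s)) (seq_path Xs \<omega>) * g s)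
        \<longlonglongrightarrow> enat_sum (N s \<omega>) (\<lambda>k. Xs k \<omega>) * g s"
      using tendsto_grid_integrand[OF \<omega>] by simp
    have "\<bar>enat_sum (counting_path N \<omega> (rgrid (mesh i) s)) (seq_path Xs \<omega>) * g s\<bar> \<le> ?c * \<bar>g s\<bar>" for i s
    proof (cases "s \<in> {0..<t}")
      case True
      \<comment> \<open>The sampling time stays within \<open>[0,t]\<close>, so monotonicity bounds
        the count by \<open>K\<close> for every mesh.\<close>
      then have "rgrid (mesh i) s \<le> real (Suc i) * mesh i"
        by (intro rgrid_le mesh_pos) (auto simp: mesh_def)
      also have "\<dots> = t" by (simp add: mesh_def)
      finally have "counting_path N \<omega> (rgrid (mesh i) s) \<le> enat K"
        using rgrid_nonneg[OF mesh_pos] monotone_onD[OF N_mono[OF \<omega>], of "rgrid (mesh i) s" t] t_pos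
        by (simp add: counting_path_props(3)[OF \<omega>] K)
      then show ?thesis
        unfolding abs_mult by (intro mult_right_mono abs_enat_sum_le) auto
    next
      case False
      then show ?thesis by (simp add: g_0)
    qed
    then show "AE s in lborel. norm (enat_sum (counting_path N \<omega> (rgrid (mesh i) s)) (seq_path Xs \<omega>) * g s)
        \<le> ?c * \<bar>g s\<bar>" for i
      by simp
    show "integrable lborel (\<lambda>s. ?c * \<bar>g s\<bar>)"
      using g by simp
    have "(\<lambda>s. enat_sum (N s \<omega>) (\<lambda>k. Xs k \<omega>) * g s) \<in> borel_measurable lborel"
      using measurable_Pair2[OF measurable_path_integrand \<omega>] by simp
    then show "(\<lambda>s. enat_sum (N s \<omega>) (\<lambda>k. Xs k \<omega>) * g s) \<in> borel_measurable lborel" .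
    have "(counting_path N \<omega>, seq_path Xs \<omega>) \<in> space (counting_path_space \<Otimes>\<^sub>M seq_path_space)"
      using measurable_space[OF measurable_path \<omega>] .
    from measurable_Pair2[OF measurable_grid_integrand[OF mesh_pos] this]
    show "(\<lambda>s. enat_sum (counting_path N \<omega> (rgrid (mesh i) s)) (seq_path Xs \<omega>) * g s) \<in> borel_measurable lborel" for i
      by simp
  qed
qed

text \<open>Both sides are limits of the same sequence, the characteristic functions of the grid
  integrals.\<close>

lemma path_integral_cf:
  "(\<integral>\<omega>. iexp (\<theta> * path_integral \<omega>) \<partial>M)
    = exp (\<integral>s. (indicator {0..<t} s * lam s) *\<^sub>R (\<phi> (\<theta> * F s) - 1) \<partial>lborel)"
proof (rule LIMSEQ_unique)
  show "(\<lambda>i. \<integral>\<omega>. iexp (\<theta> * grid_integral (mesh i) (counting_path N \<omega>, seq_path Xs \<omega>)) \<partial>M)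
      \<longlonglongrightarrow> (\<integral>\<omega>. iexp (\<theta> * path_integral \<omega>) \<partial>M)"
  proof (rule integral_dominated_convergence[where w="\<lambda>_. 1"])
    have "(\<lambda>i. iexp (\<theta> * grid_integral (mesh i) (counting_path N \<omega>, seq_path Xs \<omega>)))
        \<longlonglongrightarrow> iexp (\<theta> * path_integral \<omega>)" if "\<omega> \<in> space M" "N t \<omega> \<noteq> \<infinity>" for \<omega>
      by (intro tendsto_intros tendsto_grid_integral that)
    then show "AE \<omega> in M. (\<lambda>i. iexp (\<theta> * grid_integral (mesh i) (counting_path N \<omega>, seq_path Xs \<omega>)))
        \<longlonglongrightarrow> iexp (\<theta> * path_integral \<omega>)"
      by (intro AE_mp[OF N_finite AE_I2]) simp
    have [measurable]: "(\<lambda>\<omega>. grid_integral (mesh i) (counting_path N \<omega>, seq_path Xs \<omega>)) \<in> borel_measurable M" for i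
      by (rule measurable_compose[OF measurable_path measurable_grid_integral[OF mesh_pos]])
    show "(\<lambda>\<omega>. iexp (\<theta> * grid_integral (mesh i) (counting_path N \<omega>, seq_path Xs \<omega>))) \<in> borel_measurable M" for i
      by measurable
    show "AE \<omega> in M. norm (iexp (\<theta> * grid_integral (mesh i) (counting_path N \<omega>, seq_path Xs \<omega>))) \<le> 1" for i
      by (simp only: norm_iexp_mult) simp
  qed (simp_all del: of_real_mult)
  \<comment> \<open>Here \<open>lam\<close> enters only as an integrable weight; the convergence
    comes from the continuity of \<open>F\<close> and \<open>\<phi>\<close> along
    \<open>lgrid (mesh i) s\<close>.\<close>
  have "(\<lambda>i. \<integral>s. (indicator {0..<t} s * lam s) *\<^sub>R (\<phi> (\<theta> * F (lgrid (mesh i) s)) - 1) \<partial>lborel)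
      \<longlonglongrightarrow> (\<integral>s. (indicator {0..<t} s * lam s) *\<^sub>R (\<phi> (\<theta> * F s) - 1) \<partial>lborel)"
  proof (rule integral_dominated_convergence[where w="\<lambda>s. \<bar>indicator {0..<t} s *\<^sub>R lam s\<bar> * 2"])
    have bound: "norm (\<phi> y - 1) \<le> 2" for y
      using norm_triangle_ineq4[of "\<phi> y" 1] norm_\<phi>_le[of y] by simp
    have [measurable]: "(\<lambda>s. \<phi> (\<theta> * F s) - 1) \<in> borel_measurable borel"
        "(\<lambda>s. \<phi> (\<theta> * F (lgrid (mesh i) s)) - 1) \<in> borel_measurable borel" for i
      by measurable
    have lim: "(\<lambda>i. (indicator {0..<t} s * lam s) *\<^sub>R (\<phi> (\<theta> * F (lgrid (mesh i) s)) - 1))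
        \<longlonglongrightarrow> (indicator {0..<t} s * lam s) *\<^sub>R (\<phi> (\<theta> * F s) - 1)" for s
    proof (cases "0 \<le> s")
      case True
      have "(\<lambda>i. F (lgrid (mesh i) s)) \<longlonglongrightarrow> F s"
        using F_cont tendsto_lgrid[OF tendsto_mesh mesh_pos True]
        by (auto simp: continuous_on_eq_continuous_at intro: isCont_tendsto_compose)
      then have "(\<lambda>i. \<phi> (\<theta> * F (lgrid (mesh i) s))) \<longlonglongrightarrow> \<phi> (\<theta> * F s)"
        by (intro isCont_tendsto_compose[OF X.isCont_char] tendsto_intros)
      then show ?thesis by (intro tendsto_intros)
    qed simp
    show "AE s in lborel. (\<lambda>i. (indicator {0..<t} s * lam s) *\<^sub>R (\<phi> (\<theta> * F (lgrid (mesh i) s)) - 1))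
        \<longlonglongrightarrow> (indicator {0..<t} s * lam s) *\<^sub>R (\<phi> (\<theta> * F s) - 1)"
      using lim by (intro AE_I2)
    show "AE s in lborel. norm ((indicator {0..<t} s * lam s) *\<^sub>R (\<phi> (\<theta> * F (lgrid (mesh i) s)) - 1))
        \<le> \<bar>indicator {0..<t} s *\<^sub>R lam s\<bar> * 2" for i
      unfolding norm_scaleR real_scaleR_def by (intro AE_I2 mult_left_mono bound) simp
    show "integrable lborel (\<lambda>s. \<bar>indicator {0..<t} s *\<^sub>R lam s\<bar> * 2)"
      using lam_indicator_integrable by (intro integrable_mult_left integrable_abs)
    show "(\<lambda>s. (indicator {0..<t} s * lam s) *\<^sub>R (\<phi> (\<theta> * F s) - 1)) \<in> borel_measurable lborel"
      by (rule borel_measurable_integrable, rule integrable_lam_mult[OF _ bound]) measurable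
    show "(\<lambda>s. (indicator {0..<t} s * lam s) *\<^sub>R (\<phi> (\<theta> * F (lgrid (mesh i) s)) - 1)) \<in> borel_measurable lborel" for i
      by (rule borel_measurable_integrable, rule integrable_lam_mult[OF _ bound]) measurable
  qed
  then show "(\<lambda>i. \<integral>\<omega>. iexp (\<theta> * grid_integral (mesh i) (counting_path N \<omega>, seq_path Xs \<omega>)) \<partial>M)
      \<longlonglongrightarrow> exp (\<integral>s. (indicator {0..<t} s * lam s) *\<^sub>R (\<phi> (\<theta> * F s) - 1) \<partial>lborel)"
    by (subst grid_integral_cf[OF _ mesh_def]) (auto intro: tendsto_exp)
qed

section \<open>The characteristic function of the randomly weighted sum\<close>

lemma rate_eq: "rate 0 t = (\<integral>s. indicator {0..<t} s * lam s \<partial>lborel)"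
  unfolding rate_def set_lebesgue_integral_def
proof (rule integral_cong_AE)
  show "AE s in lborel. indicat_real {0..t} s *\<^sub>R lam s = indicat_real {0..<t} s * lam s"
    using AE_lborel_singleton[of t] by (rule eventually_mono) (auto simp: indicator_def)
qed (use lam_integrable[of t] lam_indicator_integrable t_pos in \<open>auto simp: set_integrable_def\<close>)

text \<open>Averaging out the \<open>L k\<close>, the \<open>Xs k\<close> and \<open>N t\<close> in
  turn leaves a Poisson generating function, evaluated at the expectation of
  \<open>\<psi> (X \<omega>)\<close>. The normalising factor in the density of \<open>L 1\<close>
  cancels against the Poisson parameter \<open>rate 0 t\<close>.\<close>

lemma lambda_sum_cf:
  fixes u :: "real \<Rightarrow> real"
  assumes L: "lambda_sequence lam N Xs t L" and rate: "0 < rate 0 t"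
    and lam_nonneg: "\<And>s. 0 \<le> s \<Longrightarrow> 0 \<le> lam s"
    and u [measurable]: "u \<in> borel_measurable borel"
  shows "(\<integral>\<omega>. iexp (\<theta> * enat_sum (N t \<omega>) (\<lambda>k. Xs k \<omega> * u (L k \<omega>))) \<partial>M)
    = exp (\<integral>s. (indicator {0..<t} s * lam s) *\<^sub>R (\<phi> (\<theta> * u s) - 1) \<partial>lborel)"
proof -
  \<comment> \<open>Characteristic function of a single summand given that its jump size is
    \<open>x\<close>; it serves for every index because the \<open>L k\<close> are identically
    distributed.\<close>
  define \<psi> where "\<psi> x = (\<integral>\<omega>. iexp (\<theta> * x * u (L 1 \<omega>)) \<partial>M)" for x
  have L_iid: "iid {1..} L"
    and L_distr: "distributed M lborel (L 1) (\<lambda>s. ennreal (indicator {0..t} s * lam s / rate 0 t))"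
    and L_ind: "indep_elements (counting_path_space \<Otimes>\<^sub>M seq_path_space)
        (\<lambda>\<omega>. (counting_path N \<omega>, seq_path Xs \<omega>)) seq_path_space (seq_path L)"
    using L rate t_pos by (auto simp: lambda_sequence_def rate_def)
  have L_meas [measurable]: "1 \<le> k \<Longrightarrow> L k \<in> borel_measurable M" for k
    using L by (auto simp: lambda_sequence_def)
  have [measurable]: "L 1 \<in> borel_measurable M" by simp
  have L_copies: "iid_copies L (L 1)"
    unfolding iid_copies_def
  proof (intro conjI allI impI L_iid)
    show "distr M borel (L k) = distr M borel (L 1)" if "1 \<le> k" for k
      using L_iid that unfolding iid_def by (meson atLeast_iff order_refl)
  qed simp
  have [measurable]: "counting_path N \<in> measurable M counting_path_space"
      "seq_path Xs \<in> measurable M seq_path_space"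
    using ind by (auto simp: indep_elements_def)
  have \<psi>_meas [measurable]: "\<psi> \<in> borel_measurable borel"
    unfolding \<psi>_def by (rule borel_measurable_lebesgue_integral) measurable
  have norm_\<psi>: "norm (\<psi> x) \<le> 1" for x
  proof -
    have "norm (\<psi> x) \<le> (\<integral>\<omega>. norm (iexp (\<theta> * x * u (L 1 \<omega>))) \<partial>M)"
      unfolding \<psi>_def by (rule integral_norm_bound)
    then show ?thesis unfolding norm_iexp_mult by (simp add: prob_space)
  qed
  have n_t: "(\<lambda>n. n t) \<in> measurable counting_path_space (count_space UNIV)"
    using t_pos by (intro measurable_component_singleton) simp
  have x_k: "(\<lambda>x. x k) \<in> borel_measurable seq_path_space" if "1 \<le> k" for k
    using that by (intro measurable_component_singleton) simp
  have N_t: "counting_path N \<omega> t = N t \<omega>" for \<omega>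
    using t_pos by (simp add: counting_path_def)
  let ?G = "\<lambda>p. iexp (\<theta> * enat_sum (fst (fst p) t) (\<lambda>k. snd (fst p) k * u (snd p k)))"
  have sum_meas: "(\<lambda>p. enat_sum (fst (fst p) t) (\<lambda>k. snd (fst p) k * u (snd p k)))
      \<in> borel_measurable ((counting_path_space \<Otimes>\<^sub>M seq_path_space) \<Otimes>\<^sub>M seq_path_space)"
    by (intro measurable_enat_sum borel_measurable_times measurable_compose[OF _ n_t]
        measurable_compose[OF _ x_k] measurable_compose[OF _ u]) measurable
  then have G_meas: "?G \<in> borel_measurable ((counting_path_space \<Otimes>\<^sub>M seq_path_space) \<Otimes>\<^sub>M seq_path_space)"
    by measurable
  have sum_eq: "enat_sum n (\<lambda>k. seq_path Xs \<omega> k * u (seq_path L \<omega>' k))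
      = enat_sum n (\<lambda>k. Xs k \<omega> * u (L k \<omega>'))" for n \<omega> \<omega>'
    by (rule enat_sum_cong) (simp add: seq_path_def)
  have "(\<integral>\<omega>. iexp (\<theta> * enat_sum (N t \<omega>) (\<lambda>k. Xs k \<omega> * u (L k \<omega>))) \<partial>M)
      = (\<integral>\<omega>. ?G ((counting_path N \<omega>, seq_path Xs \<omega>), seq_path L \<omega>) \<partial>M)"
    by (simp add: sum_eq N_t)
  also have "\<dots> = (\<integral>\<omega>. (\<integral>\<omega>'. ?G ((counting_path N \<omega>, seq_path Xs \<omega>), seq_path L \<omega>') \<partial>M) \<partial>M)"
    by (rule indep_elements_integral[OF L_ind G_meas norm_iexp_mult[THEN eq_refl]])
  also have "\<dots> = (\<integral>\<omega>. (\<Prod>k=1..the_enat (counting_path N \<omega> t). \<psi> (seq_path Xs \<omega> k)) \<partial>M)"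
  proof (rule integral_cong_AE)
    have "(\<integral>\<omega>'. ?G ((counting_path N \<omega>, seq_path Xs \<omega>), seq_path L \<omega>') \<partial>M)
        = (\<Prod>k=1..the_enat (counting_path N \<omega> t). \<psi> (seq_path Xs \<omega> k))"
      if fin: "N t \<omega> \<noteq> \<infinity>" for \<omega>
    proof -
      obtain K where K: "N t \<omega> = enat K" using fin by auto
      have "(\<integral>\<omega>'. ?G ((counting_path N \<omega>, seq_path Xs \<omega>), seq_path L \<omega>') \<partial>M)
          = (\<integral>\<omega>'. (\<Prod>k=1..K. iexp (\<theta> * Xs k \<omega> * u (L k \<omega>'))) \<partial>M)"
        by (simp add: sum_eq N_t K sum_distrib_left exp_sum[symmetric] mult.assoc)
      also have "\<dots> = (\<Prod>k=1..K. \<integral>\<omega>'. iexp (\<theta> * Xs k \<omega> * u (L k \<omega>')) \<partial>M)"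
      proof (rule indep_integral_prod[where u="\<lambda>k x. iexp (\<theta> * Xs k \<omega> * u x)"])
        show "indep_vars (\<lambda>_. borel) L {1..}"
          using L_iid by (simp add: iid_def)
      qed (simp_all del: of_real_mult)
      also have "\<dots> = (\<Prod>k=1..K. \<psi> (Xs k \<omega>))"
        unfolding \<psi>_def
        by (intro prod.cong refl iid_copies_integral_eq[OF L_copies, where u="\<lambda>x. iexp (\<theta> * Xs _ \<omega> * u x)"]) auto
      finally show ?thesis
        by (simp add: N_t K seq_path_def)
    qed
    then show "AE \<omega> in M. (\<integral>\<omega>'. ?G ((counting_path N \<omega>, seq_path Xs \<omega>), seq_path L \<omega>') \<partial>M)
        = (\<Prod>k=1..the_enat (counting_path N \<omega> t). \<psi> (seq_path Xs \<omega> k))"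
      using N_finite by (rule eventually_mono[rotated])
    have [measurable]: "seq_path L \<in> measurable M seq_path_space"
      using L_ind by (auto simp: indep_elements_def)
    have "(\<lambda>p. ((counting_path N (fst p), seq_path Xs (fst p)), seq_path L (snd p)))
        \<in> measurable (M \<Otimes>\<^sub>M M) ((counting_path_space \<Otimes>\<^sub>M seq_path_space) \<Otimes>\<^sub>M seq_path_space)"
      by measurable
    from measurable_compose[OF this G_meas]
    show "(\<lambda>\<omega>. \<integral>\<omega>'. ?G ((counting_path N \<omega>, seq_path Xs \<omega>), seq_path L \<omega>') \<partial>M) \<in> borel_measurable M"
      by (intro borel_measurable_lebesgue_integral) (simp add: split_beta')
    \<comment> \<open>The number of factors is random, so measurability is checked separately for
      each of the countably many values of the count.\<close>
    show "(\<lambda>\<omega>. \<Prod>k=1..the_enat (counting_path N \<omega> t). \<psi> (seq_path Xs \<omega> k)) \<in> borel_measurable M"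
    proof (rule measurable_compose_countable[where f="\<lambda>n \<omega>. \<Prod>k=1..the_enat n. \<psi> (seq_path Xs \<omega> k)"])
      show "(\<lambda>\<omega>. \<Prod>k=1..the_enat n. \<psi> (seq_path Xs \<omega> k)) \<in> borel_measurable M" for n
        by (intro borel_measurable_prod measurable_compose[OF _ \<psi>_meas]) (auto simp: seq_path_def)
    qed (simp add: N_t t_pos less_imp_le)
  qed
  \<comment> \<open>Second stage: the jump sizes are decoupled from the counting process by the
    independence in \<open>compound_poisson\<close>.\<close>
  also have "\<dots> = (\<integral>\<omega>. (\<integral>\<omega>'. (\<Prod>k=1..the_enat (counting_path N \<omega> t). \<psi> (seq_path Xs \<omega>' k)) \<partial>M) \<partial>M)"
  proof -
    let ?H = "\<lambda>p. \<Prod>k=1..the_enat (fst p t). \<psi> (snd p k)"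
    have "?H \<in> borel_measurable (counting_path_space \<Otimes>\<^sub>M seq_path_space)"
    proof (rule measurable_compose_countable[where f="\<lambda>n p. \<Prod>k=1..the_enat n. \<psi> (snd p k)"])
      show "(\<lambda>p. \<Prod>k=1..the_enat n. \<psi> (snd p k)) \<in> borel_measurable (counting_path_space \<Otimes>\<^sub>M seq_path_space)" for n
        by (intro borel_measurable_prod measurable_compose[OF _ \<psi>_meas] measurable_compose[OF _ x_k]) auto
      show "(\<lambda>p. fst p t) \<in> measurable (counting_path_space \<Otimes>\<^sub>M seq_path_space) (count_space UNIV)"
        by (rule measurable_compose[OF measurable_fst n_t])
    qed
    moreover have "norm (?H p) \<le> 1" for p
      unfolding prod_norm[symmetric] by (intro prod_le_1 conjI norm_ge_zero norm_\<psi>)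
    ultimately show ?thesis
      using indep_elements_integral[OF ind, of ?H 1] by simp
  qed
  also have "\<dots> = (\<integral>\<omega>. (\<integral>\<omega>'. \<psi> (X \<omega>') \<partial>M) ^ the_enat (N t \<omega>) \<partial>M)"
  proof (rule Bochner_Integration.integral_cong[OF refl])
    fix \<omega>
    have "(\<integral>\<omega>'. (\<Prod>k=1..K. \<psi> (seq_path Xs \<omega>' k)) \<partial>M) = (\<integral>\<omega>'. \<psi> (X \<omega>') \<partial>M) ^ K" for K
    proof -
      have "(\<integral>\<omega>'. (\<Prod>k=1..K. \<psi> (seq_path Xs \<omega>' k)) \<partial>M) = (\<integral>\<omega>'. (\<Prod>k=1..K. \<psi> (Xs k \<omega>')) \<partial>M)"
        by (simp add: seq_path_def)
      also have "\<dots> = (\<Prod>k=1..K. \<integral>\<omega>'. \<psi> (Xs k \<omega>') \<partial>M)"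
        by (rule indep_integral_prod[OF Xs_indep, where u="\<lambda>_. \<psi>"]) (auto intro: norm_\<psi>)
      also have "\<dots> = (\<Prod>k=1..K. \<integral>\<omega>'. \<psi> (X \<omega>') \<partial>M)"
        by (intro prod.cong refl iid_copies_integral_eq[OF iid]) auto
      finally show ?thesis by simp
    qed
    then show "(\<integral>\<omega>'. (\<Prod>k=1..the_enat (counting_path N \<omega> t). \<psi> (seq_path Xs \<omega>' k)) \<partial>M)
        = (\<integral>\<omega>'. \<psi> (X \<omega>') \<partial>M) ^ the_enat (N t \<omega>)"
      by (simp add: N_t)
  qed
  also have "\<dots> = exp (of_real (rate 0 t) * ((\<integral>\<omega>. \<psi> (X \<omega>) \<partial>M) - 1))"
  proof (rule poisson_weights_generating_function[OF _ N_prob_0])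
    have "norm (\<integral>\<omega>. \<psi> (X \<omega>) \<partial>M) \<le> (\<integral>\<omega>. norm (\<psi> (X \<omega>)) \<partial>M)"
      by (rule integral_norm_bound)
    also have "\<dots> \<le> (\<integral>\<omega>. 1 \<partial>M)"
      by (intro integral_mono integrable_const_bound[where B=1]) (auto intro: norm_\<psi>)
    finally show "norm (\<integral>\<omega>. \<psi> (X \<omega>) \<partial>M) \<le> 1"
      by (simp add: prob_space)
  qed (use t_pos in simp)
  also have "of_real (rate 0 t) * ((\<integral>\<omega>. \<psi> (X \<omega>) \<partial>M) - 1)
      = (\<integral>s. (indicator {0..<t} s * lam s) *\<^sub>R (\<phi> (\<theta> * u s) - 1) \<partial>lborel)"
  proof -
    \<comment> \<open>\<open>\<psi> (X \<omega>)\<close> already averages \<open>L 1\<close> over a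
      separate sample point, so exchanging the two averages is Fubini on the square of the space.
      The inner average is then a value of \<open>\<phi>\<close>.\<close>
    interpret MM: pair_prob_space M M ..
    have "integrable (M \<Otimes>\<^sub>M M) (\<lambda>(\<omega>, \<omega>'). iexp (\<theta> * X \<omega> * u (L 1 \<omega>')))"
      by (rule MM.integrable_const_bound[where B=1])
        (auto simp: split_beta' simp del: of_real_mult intro!: AE_I2 norm_iexp_mult[THEN eq_refl])
    then have "(\<integral>\<omega>'. (\<integral>\<omega>. iexp (\<theta> * X \<omega> * u (L 1 \<omega>')) \<partial>M) \<partial>M)
        = (\<integral>\<omega>. (\<integral>\<omega>'. iexp (\<theta> * X \<omega> * u (L 1 \<omega>')) \<partial>M) \<partial>M)"
      by (rule MM.Fubini_integral)
    moreover have "(\<integral>\<omega>. iexp (\<theta> * X \<omega> * u (L 1 \<omega>')) \<partial>M) = \<phi> (\<theta> * u (L 1 \<omega>'))" for \<omega>'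
      unfolding \<phi>_eq by (simp add: ac_simps)
    ultimately have "(\<integral>\<omega>. \<psi> (X \<omega>) \<partial>M) = (\<integral>\<omega>. \<phi> (\<theta> * u (L 1 \<omega>)) \<partial>M)"
      by (simp add: \<psi>_def)
    also have "\<dots> = (\<integral>s. \<phi> (\<theta> * u s) \<partial>distr M lborel (L 1))"
      by (rule integral_distr[symmetric]) measurable
    also have "\<dots> = (\<integral>s. \<phi> (\<theta> * u s) \<partial>density lborel (\<lambda>s. ennreal (indicator {0..t} s * lam s / rate 0 t)))"
      using L_distr by (simp add: distributed_def)
    also have "\<dots> = (\<integral>s. (indicator {0..t} s * lam s / rate 0 t) *\<^sub>R \<phi> (\<theta> * u s) \<partial>lborel)"
    proof (rule integral_density)
      have "(\<lambda>s. indicator {0..t} s * lam s) \<in> borel_measurable lborel"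
        using lam_integrable[of t] t_pos by (auto simp: set_integrable_def)
      then show "(\<lambda>s. indicator {0..t} s * lam s / rate 0 t) \<in> borel_measurable lborel"
        by simp
      show "AE s in lborel. 0 \<le> indicator {0..t} s * lam s / rate 0 t"
        using lam_nonneg rate by (intro AE_I2) (auto simp: indicator_def)
    qed measurable
    \<comment> \<open>Dropping the null point \<open>t\<close> from the support of the density gives
      the weight that occurs in \<open>path_integral_cf\<close>.\<close>
    also have "\<dots> = (\<integral>s. ((indicator {0..<t} s * lam s) *\<^sub>R \<phi> (\<theta> * u s)) /\<^sub>R rate 0 t \<partial>lborel)"
    proof (rule integral_cong_AE)
      show "AE s in lborel. (indicator {0..t} s * lam s / rate 0 t) *\<^sub>R \<phi> (\<theta> * u s)
          = ((indicator {0..<t} s * lam s) *\<^sub>R \<phi> (\<theta> * u s)) /\<^sub>R rate 0 t"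
        using AE_lborel_singleton[of t]
        by (rule eventually_mono) (auto simp: indicator_def divide_inverse)
      have [measurable]: "(\<lambda>s. indicator {0..t} s * lam s) \<in> borel_measurable borel"
          "(\<lambda>s. indicator {0..<t} s * lam s) \<in> borel_measurable borel"
        using lam_integrable[of t] lam_indicator_integrable t_pos
        by (auto simp: set_integrable_def dest: borel_measurable_integrable)
      show "(\<lambda>s. (indicator {0..t} s * lam s / rate 0 t) *\<^sub>R \<phi> (\<theta> * u s)) \<in> borel_measurable lborel"
        "(\<lambda>s. ((indicator {0..<t} s * lam s) *\<^sub>R \<phi> (\<theta> * u s)) /\<^sub>R rate 0 t) \<in> borel_measurable lborel"
        by measurable
    qed
    finally have "of_real (rate 0 t) * (\<integral>\<omega>. \<psi> (X \<omega>) \<partial>M)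
        = (\<integral>s. (indicator {0..<t} s * lam s) *\<^sub>R \<phi> (\<theta> * u s) \<partial>lborel)"
      using rate by (simp add: scaleR_conv_of_real)
    \<comment> \<open>Writing the parameter as an integral of the same weight lets the term
      \<open>- 1\<close> be absorbed under the integral.\<close>
    moreover have "of_real (rate 0 t) = (\<integral>s. (indicator {0..<t} s * lam s) *\<^sub>R (1 :: complex) \<partial>lborel)"
      using lam_indicator_integrable by (subst integral_scaleR_left) (simp_all add: rate_eq scaleR_conv_of_real)
    moreover have "integrable lborel (\<lambda>s. (indicator {0..<t} s * lam s) *\<^sub>R \<phi> (\<theta> * u s))"
      by (rule integrable_lam_mult[where c=1]) (measurable, rule norm_\<phi>_le)
    moreover have "integrable lborel (\<lambda>s. (indicator {0..<t} s * lam s) *\<^sub>R (1 :: complex))"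
      by (rule integrable_lam_mult[where c=1]) auto
    ultimately show ?thesis
      by (simp only: scaleR_diff_right right_diff_distrib mult_1_right Bochner_Integration.integral_diff)
  qed
  finally show ?thesis .
qed

end

section \<open>Transfer from Lebesgue to Borel functions, and the conclusion\<close>

text \<open>The given \<open>f\<close> is only Lebesgue measurable on the interval, whereas the
  computation runs with a Borel function that agrees with it there almost everywhere. Completion
  does not change the integral of a Borel function.\<close>

lemma integral_lebesgue_eq_lborel:
  fixes k h :: "real \<Rightarrow> real"
  assumes h: "h \<in> borel_measurable lborel" and eq: "AE s in lebesgue. k s = h s"
  shows "integral\<^sup>L lebesgue k = integral\<^sup>L lborel h"
proof -
  have h': "h \<in> borel_measurable lebesgue"
    using h by (rule measurable_completion)
  \<comment> \<open>Completeness of \<open>lebesgue\<close> makes measurable any function that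
    agrees almost everywhere with a measurable one.\<close>
  moreover have "k \<in> borel_measurable lebesgue"
    using eq by (intro borel_measurable_AE[OF h']) (simp add: eq_commute)
  ultimately have "integral\<^sup>L lebesgue k = integral\<^sup>L lebesgue h"
    using eq by (intro integral_cong_AE)
  then show ?thesis
    by (simp add: integral_completion[OF h])
qed

theorem theorem4p4:
  fixes P :: "'a measure"
    and T t :: real
    and f lam :: "real \<Rightarrow> real"
    and X :: "'a \<Rightarrow> real"
    and N :: "real \<Rightarrow> 'a \<Rightarrow> enat"
    and Xs L :: "nat \<Rightarrow> 'a \<Rightarrow> real"
    and M :: "real \<Rightarrow> 'a \<Rightarrow> real"
  assumes "prob_space P"
    and "T > 0"
    and "set_integrable lebesgue {0..T} f"
    and "continuous_on {0..} lam"
    and "\<forall>s\<ge>0. 0 \<le> lam s"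
    and "\<forall>s\<ge>0. set_integrable lborel {0..s} lam"
    and "prob_space.compound_poisson P lam X N Xs M"
    and "0 \<le> t" and "t \<le> T"
    and "prob_space.lambda_sequence P lam N Xs t L"
    and "prob_space.condition_II P (\<lambda>n \<omega>. \<Sum>k=1..n. Xs k \<omega>) f t N"
  shows "prob_space.eq_in_distribution P
           (\<lambda>\<omega>. LINT s:{0..t}|lebesgue. M s \<omega> * f s)
           (\<lambda>\<omega>. enat_sum (N t \<omega>) (\<lambda>k. Xs k \<omega> * (LINT s:{L k \<omega>..t}|lebesgue. f s)))"
    (is "prob_space.eq_in_distribution P ?Y ?Z")
proof -
  interpret prob_space P by fact
  \<comment> \<open>Defined on the whole line because the values of \<open>L k\<close> are confined
    to \<open>[0,t]\<close> at best almost surely.\<close>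
  define F0 where "F0 x = (LINT s:{x..t}|lebesgue. f s)" for x
  have [measurable]: "F0 \<in> borel_measurable borel"
    unfolding F0_def[abs_def] by (rule borel_measurable_integral_lower_limit)
  have proc: "counting_process N" and Xs: "1 \<le> k \<Longrightarrow> Xs k \<in> borel_measurable P"
    and L: "1 \<le> k \<Longrightarrow> L k \<in> borel_measurable P"
    and M_eq: "0 \<le> s \<Longrightarrow> \<omega> \<in> space P \<Longrightarrow> M s \<omega> = enat_sum (N s \<omega>) (\<lambda>k. Xs k \<omega>)" for k s \<omega>
    using assms(7,10)
    by (auto simp: compound_poisson_def poisson_process_def iid_copies_def iid_def indep_vars_def
        lambda_sequence_def)
  have N_t: "N t \<in> measurable P (count_space UNIV)"
    and N_0: "\<omega> \<in> space P \<Longrightarrow> N 0 \<omega> = 0"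
    and N_mono: "\<omega> \<in> space P \<Longrightarrow> mono_on {0..} (\<lambda>s. N s \<omega>)" for \<omega>
    using proc \<open>0 \<le> t\<close> by (auto simp: counting_process_def)
  have Z_meas: "?Z \<in> borel_measurable P"
    unfolding F0_def[symmetric]
    by (intro measurable_enat_sum N_t borel_measurable_times Xs measurable_compose[OF L]) simp_all
  show ?thesis
  proof (cases "t = 0")
    case True
    \<comment> \<open>For \<open>t = 0\<close> the domain of integration is a single point, and
      \<open>N 0 \<omega> = 0\<close> leaves an empty sum on the other side.\<close>
    have "?Y \<omega> = 0" for \<omega>
      unfolding set_lebesgue_integral_def True
      using AE_lebesgue_singleton[of 0] by (intro integral_eq_zero_AE, eventually_elim) simp
    then show ?thesis
      using Z_meas by (intro eq_in_distribution_AE AE_I2) (simp_all add: True N_0)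
  next
    case False
    then have t_pos: "0 < t" using \<open>0 \<le> t\<close> by simp
    have f_int: "set_integrable lebesgue {0..t} f"
      using \<open>t \<le> T\<close> by (intro set_integrable_subset[OF assms(3)]) auto
    define f1 where "f1 s = indicator {0..t} s * f s" for s
    have f1_int: "integrable lebesgue f1"
      using f_int by (simp add: f1_def[abs_def] set_integrable_def)
    obtain f' where f' [measurable]: "f' \<in> borel_measurable lborel" and f'_eq: "AE s in lborel. f1 s = f' s"
      using completion_ex_borel_measurable_real[OF borel_measurable_integrable[OF f1_int]] by blast
    \<comment> \<open>Removing the end point \<open>t\<close> costs only a null set and gives the
      half-open support that the locale asks for.\<close>
    define g where "g s = indicator {0..<t} s * f' s" for s
    have [measurable]: "g \<in> borel_measurable lborel"
      unfolding g_def by measurable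
    have g_eq: "AE s in lebesgue. f1 s = g s"
      using AE_completion[OF f'_eq] AE_lebesgue_singleton[of t]
      by eventually_elim (auto simp: f1_def g_def split: split_indicator_asm split_indicator)
    have g_leb: "g \<in> borel_measurable lebesgue"
      by (rule measurable_completion) measurable
    have "integrable lebesgue g"
      using integrable_cong_AE_imp[OF f1_int g_leb] g_eq by (simp add: eq_commute)
    then have g_int: "integrable lborel g"
      by (simp add: integrable_completion)
    interpret cpi: compound_poisson_integral P lam X N Xs M t g
      using assms t_pos g_int by unfold_locales (auto simp: g_def)
    \<comment> \<open>The exceptional null set in \<open>g_eq\<close> is the same for all
      \<open>\<omega>\<close>, so the two integrals agree at every sample point and not just almost
      surely.\<close>
    have Y_eq: "?Y \<omega> = cpi.path_integral \<omega>" if \<omega>: "\<omega> \<in> space P" for \<omega>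
    proof -
      let ?I = "\<lambda>s. enat_sum (N s \<omega>) (\<lambda>k. Xs k \<omega>) * g s"
      have I: "?I \<in> borel_measurable lborel"
        using measurable_Pair2[OF cpi.measurable_path_integrand \<omega>] by simp
      show ?thesis
        unfolding set_lebesgue_integral_def cpi.path_integral_def
        using g_eq by (intro integral_lebesgue_eq_lborel[OF I], eventually_elim)
          (auto simp: f1_def g_def M_eq[OF _ \<omega>] indicator_def split: if_splits)
    qed
    then have Y_meas: "?Y \<in> borel_measurable P"
      using cpi.measurable_path_integral by (simp cong: measurable_cong)
    show ?thesis
    proof (cases "0 < cpi.rate 0 t")
      case False
      \<comment> \<open>The rate vanishes here, so the Poisson weight of 0 is 1 and \<open>N\<close>
        is almost surely 0 on all of \<open>[0,t]\<close> by monotonicity. Both sides are then 0,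
        whatever the law of the \<open>L k\<close>.\<close>
      have "0 \<le> cpi.rate 0 t"
        using assms(5) by (auto simp: cpi.rate_def set_lebesgue_integral_def indicator_def intro!: integral_nonneg_AE)
      with False have "prob {\<omega>\<in>space P. N t \<omega> = 0} = 1"
        using cpi.N_prob_0[of 0] by (simp add: zero_enat_def)
      then have "AE \<omega> in P. \<omega> \<in> {\<omega>\<in>space P. N t \<omega> = 0}"
        by (intro AE_prob_1)
      then have "AE \<omega> in P. ?Y \<omega> = ?Z \<omega>"
      proof (rule eventually_mono)
        fix \<omega> assume "\<omega> \<in> {\<omega>\<in>space P. N t \<omega> = 0}"
        then have \<omega>: "\<omega> \<in> space P" "N t \<omega> = 0" by auto
        have "N s \<omega> = 0" if "s \<in> {0..t}" for s
          using monotone_onD[OF N_mono[OF \<omega>(1)], of s t] that \<omega>(2) by simp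
        then have "indicat_real {0..t} s *\<^sub>R (M s \<omega> * f s) = 0" for s
          by (auto simp: indicator_def M_eq[OF _ \<omega>(1)])
        then show "?Y \<omega> = ?Z \<omega>"
          by (simp only: set_lebesgue_integral_def Bochner_Integration.integral_zero \<omega>(2) enat_sum_0)
      qed
      then show ?thesis
        by (rule eq_in_distribution_AE[OF Y_meas Z_meas])
    next
      case True
      \<comment> \<open>The two functions may differ off \<open>{0..<t}\<close>, but the
        characteristic exponent weighs them only there.\<close>
      have F_eq: "F0 s = tail_integral lborel g s" if "s \<in> {0..<t}" for s
      proof -
        have [measurable]: "(\<lambda>r. indicat_real {s..} r *\<^sub>R g r) \<in> borel_measurable lborel"
          by measurable
        have "AE r in lebesgue. indicat_real {s..t} r *\<^sub>R f r = indicat_real {s..} r *\<^sub>R g r"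
          using g_eq by eventually_elim
            (use that in \<open>auto simp: f1_def g_def split: split_indicator_asm split_indicator\<close>)
        then show ?thesis
          unfolding F0_def tail_integral_def set_lebesgue_integral_def
          by (intro integral_lebesgue_eq_lborel) auto
      qed
      show ?thesis
      proof (rule eq_in_distribution_char[OF Y_meas Z_meas])
        fix \<theta>
        have "(\<integral>\<omega>. iexp (\<theta> * ?Y \<omega>) \<partial>P) = (\<integral>\<omega>. iexp (\<theta> * cpi.path_integral \<omega>) \<partial>P)"
          by (intro Bochner_Integration.integral_cong refl) (simp add: Y_eq)
        also have "\<dots> = exp (\<integral>s. (indicator {0..<t} s * lam s) *\<^sub>R
            (char (distr P borel X) (\<theta> * tail_integral lborel g s) - 1) \<partial>lborel)"
          by (rule cpi.path_integral_cf)
        also have "\<dots> = exp (\<integral>s. (indicator {0..<t} s * lam s) *\<^sub>R (char (distr P borel X) (\<theta> * F0 s) - 1) \<partial>lborel)"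
          by (intro arg_cong[where f=exp] Bochner_Integration.integral_cong refl)
            (auto simp: indicator_def F_eq)
        also have "\<dots> = (\<integral>\<omega>. iexp (\<theta> * enat_sum (N t \<omega>) (\<lambda>k. Xs k \<omega> * F0 (L k \<omega>))) \<partial>P)"
          using assms(5) by (intro cpi.lambda_sum_cf[OF assms(10) True, symmetric]) auto
        finally show "(\<integral>\<omega>. iexp (\<theta> * ?Y \<omega>) \<partial>P) = (\<integral>\<omega>. iexp (\<theta> * ?Z \<omega>) \<partial>P)"
          by (simp only: F0_def)
      qed
    qed
  qed
qed

end
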